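(* Let $A$ (written multiplicatively) and $B$ (written additively) be abelian groups of a topos $T$. An alternating biextension of $B\times B$ by $A$ with trivial underlying torsor (i.e. with underlying torsor $A\times B\times B$) is determined by, i.e. amounts to, a quadruple of maps $$g:B^3\to A,\qquad h:B^3\to A,\qquad \varphi:B^2\to A,\qquad u:B\to A$$ satisfying, for all arguments in $B$, the following conditions: (1) $g(b_2,b_3;b')\,g(b_1,b_2+b_3;b')=g(b_1+b_2,b_3;b')\,g(b_1,b_2;b')$ and $h(b;b_2',b_3')\,h(b;b_1',b_2'+b_3')=h(b;b_1'+b_2',b_3')\,h(b;b_1',b_2')$; (2) $g(b_1,b_2;b')=g(b_2,b_1;b')$ and $h(b;b_1',b_2')=h(b;b_2',b_1')$; (3) $\dfrac{h(b_1+b_2;b_1',b_2')}{h(b_1;b_1',b_2')\,h(b_2;b_1',b_2')}=\dfrac{g(b_1,b_2;b_1'+b_2')}{g(b_1,b_2;b_1')\,g(b_1,b_2;b_2')}$; (4) $\dfrac{\varphi(b_1+b_2,b')}{\varphi(b_1,b')\varphi(b_2,b')}=g(b_1,b_2;b')\,h(b';b_1,b_2)$ and $\dfrac{\varphi(b,b_1'+b_2')}{\varphi(b,b_1')\varphi(b,b_2')}=h(b;b_1',b_2')\,g(b_1',b_2';b)$; (5) $\varphi(b,b')=\varphi(b',b)$; (6) $c(b,b')=\dfrac{u(b+b')}{u(b)\,u(b')}$, where $c(b,b')=\lambda(b,b')\varphi(b,b')$ and $\lambda(b_1,b_2)=g(b_1,b_2;b_1+b_2)\,h(b_1;b_1,b_2)\,h(b_2;b_1,b_2)$;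 (7) $u(b)^2=\varphi(b,b)$. A trivialization of the alternating biextension defined by $(g,h,\varphi,u)$ is described by a map $k:B^2\to A$ such that $$g(b_1,b_2;b')=\frac{k(b_1+b_2,b')}{k(b_1,b')k(b_2,b')},\qquad h(b;b_1',b_2')=\frac{k(b,b_1'+b_2')}{k(b,b_1')k(b,b_2')},$$ $$k(x,x)=u(x),\qquad k(x,y)\,k(y,x)=\varphi(x,y).$$
   Context: Maps are morphisms of $T$ (abstract abelian groups are the case $T=$ Sets). $\wedge$ is the contracted product of $A$-torsors. Biextension: an $A$-torsor $E$ on $B\times B$, with fibres $E_{x,y}$, with partial composition laws given by morphisms of $A$-torsors $\stackrel{1}{+}:E_{x,y}\wedge E_{x',y}\to E_{x+x',y}$ and $\stackrel{2}{+}:E_{x,y}\wedge E_{x,y'}\to E_{x,y+y'}$, each associative and commutative, and compatible: $(a\stackrel{1}{+}b)\stackrel{2}{+}(c\stackrel{1}{+}d)=(a\stackrel{2}{+}c)\stackrel{1}{+}(b\stackrel{2}{+}d)$ for $a\in E_{x,y}$, $b\in E_{x',y}$, $c\in E_{x,y'}$, $d\in E_{x',y'}$. On the trivial torsor $E=A\times B\times B$ the maps $g,h$ encode the laws by $(a_1,b_1,b')\stackrel{1}{+}(a_2,b_2,b')=(a_1a_2\,g(b_1,b_2;b'),b_1+b_2,b')$ and $(a_1,b,b_1')\stackrel{2}{+}(a_2,b,b_2')=(a_1a_2\,h(b;b_1',b_2'),b,b_1'+b_2')$. Alternating biextension: the biextension structure gives canonical isomorphisms $E_{x+y,x+y}\simeq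 E_{x,x}\wedge E_{x,y}\wedge E_{y,x}\wedge E_{y,y}$, whence on the restriction $\Delta E$ of $E$ to the diagonal canonical isomorphisms $\sigma_x:E_{-x,-x}\to E_{x,x}$ (symmetry) and $\Delta E_{x+y+z}\wedge\Delta E_x\wedge\Delta E_y\wedge\Delta E_z\simeq\Delta E_{x+y}\wedge\Delta E_{x+z}\wedge\Delta E_{y+z}$ (cube structure); together these are the $\Sigma$-structure of $\Delta E$. An alternating biextension is a biextension $E$ with a section $t$ of $\Delta E$ compatible with the $\Sigma$-structure: $\sigma_x(t(-x))=t(x)$ and $t(x+y+z)\wedge t(x)\wedge t(y)\wedge t(z)$ corresponds to $t(x+y)\wedge t(x+z)\wedge t(y+z)$. The map $u$ describes the section $t$. Such a $t$ determines an anti-symmetry structure on $E$: the section $\pi$ of $E\wedge s^*E$ ($s$ the exchange of factors of $B^2$) whose value $\pi(x,y)\in E_{x,y}\wedge E_{y,x}$ is the image of $t(x+y)\wedge t(x)^{-1}\wedge t(y)^{-1}$; it trivializes $E\wedge s^*E$ as a biextension compatibly with the exchange of factors. The map $\varphi$ describes $\pi$. (Equivalently, an alternating structure is an anti-symmetry structure $\pi$ together with a splitting $t$ of the extension $\Delta E$ of $B$ by $A$ determined by $\pi$, such that $t(x)\wedge t(x)=\pi(x,x)$.) A trivialization of an alternating biextension is a section of $E$ compatible with both partial laws, whose restriction to the diagonal is $t$. *)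

theory Defs
  imports "HOL-Algebra.Group" "HOL-Library.FuncSet"
begin

section \<open>Sites, sheaves and their morphisms\<close>

text \<open>
  A topos is taken to be the category of sheaves of sets on a small site. Its objects are sheaves,
  its morphisms are natural transformations, and its abelian groups are sheaves of abelian groups.
  Composition is written in the usual order: \<open>cmp T f g\<close> is \<open>f\<close> after \<open>g\<close>.
\<close>

record ('o, 'm) site_data =
  Ob :: "'o set"
  Ar :: "'m set"
  src :: "'m \<Rightarrow> 'o"
  tgt :: "'m \<Rightarrow> 'o"
  idn :: "'o \<Rightarrow> 'm"
  cmp :: "'m \<Rightarrow> 'm \<Rightarrow> 'm"
  Cov :: "'o \<Rightarrow> 'm set set"

definition sieve :: "('o, 'm) site_data \<Rightarrow> 'o \<Rightarrow> 'm set \<Rightarrow> bool" where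
  "sieve T U S \<longleftrightarrow> S \<subseteq> {f \<in> Ar T. tgt T f = U} \<and>
     (\<forall>f\<in>S. \<forall>g\<in>Ar T. tgt T g = src T f \<longrightarrow> cmp T f g \<in> S)"

definition pullback_sieve :: "('o, 'm) site_data \<Rightarrow> 'm \<Rightarrow> 'm set \<Rightarrow> 'm set" where
  "pullback_sieve T f S = {g \<in> Ar T. tgt T g = src T f \<and> cmp T f g \<in> S}"

locale small_category =
  fixes T :: "('o, 'm) site_data"
  assumes src_Ob: "f \<in> Ar T \<Longrightarrow> src T f \<in> Ob T"
    and tgt_Ob: "f \<in> Ar T \<Longrightarrow> tgt T f \<in> Ob T"
    and idn_Ar: "U \<in> Ob T \<Longrightarrow> idn T U \<in> Ar T"
    and src_idn: "U \<in> Ob T \<Longrightarrow> src T (idn T U) = U"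
    and tgt_idn: "U \<in> Ob T \<Longrightarrow> tgt T (idn T U) = U"
    and cmp_Ar: "\<lbrakk>f \<in> Ar T; g \<in> Ar T; tgt T g = src T f\<rbrakk> \<Longrightarrow> cmp T f g \<in> Ar T"
    and src_cmp: "\<lbrakk>f \<in> Ar T; g \<in> Ar T; tgt T g = src T f\<rbrakk> \<Longrightarrow> src T (cmp T f g) = src T g"
    and tgt_cmp: "\<lbrakk>f \<in> Ar T; g \<in> Ar T; tgt T g = src T f\<rbrakk> \<Longrightarrow> tgt T (cmp T f g) = tgt T f"
    and cmp_idn_left: "f \<in> Ar T \<Longrightarrow> cmp T (idn T (tgt T f)) f = f"
    and cmp_idn_right: "f \<in> Ar T \<Longrightarrow> cmp T f (idn T (src T f)) = f"
    and cmp_assoc: "\<lbrakk>f \<in> Ar T; g \<in> Ar T; h \<in> Ar T; tgt T g = src T f; tgt T h = src T g\<rbrakk>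
      \<Longrightarrow> cmp T (cmp T f g) h = cmp T f (cmp T g h)"

locale site = small_category T for T :: "('o, 'm) site_data" +
  assumes Cov_sieve: "\<lbrakk>U \<in> Ob T; S \<in> Cov T U\<rbrakk> \<Longrightarrow> sieve T U S"
    and Cov_maximal: "U \<in> Ob T \<Longrightarrow> {f \<in> Ar T. tgt T f = U} \<in> Cov T U"
    and Cov_stable: "\<lbrakk>f \<in> Ar T; S \<in> Cov T (tgt T f)\<rbrakk> \<Longrightarrow> pullback_sieve T f S \<in> Cov T (src T f)"
    and Cov_transitive: "\<lbrakk>U \<in> Ob T; S \<in> Cov T U; sieve T U R;
        \<And>f. f \<in> S \<Longrightarrow> pullback_sieve T f R \<in> Cov T (src T f)\<rbrakk> \<Longrightarrow> R \<in> Cov T U"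

record ('o, 'm, 'x) presheaf_data =
  sec :: "'o \<Rightarrow> 'x set"
  res :: "'m \<Rightarrow> 'x \<Rightarrow> 'x"

definition presheaf :: "('o, 'm) site_data \<Rightarrow> ('o, 'm, 'x) presheaf_data \<Rightarrow> bool" where
  "presheaf T F \<longleftrightarrow>
     (\<forall>f\<in>Ar T. res F f \<in> sec F (tgt T f) \<rightarrow> sec F (src T f)) \<and>
     (\<forall>U\<in>Ob T. \<forall>x\<in>sec F U. res F (idn T U) x = x) \<and>
     (\<forall>f\<in>Ar T. \<forall>g\<in>Ar T. tgt T g = src T f \<longrightarrow>
        (\<forall>x\<in>sec F (tgt T f). res F (cmp T f g) x = res F g (res F f x)))"

definition sheaf :: "('o, 'm) site_data \<Rightarrow> ('o, 'm, 'x) presheaf_data \<Rightarrow> bool" where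
  "sheaf T F \<longleftrightarrow> presheaf T F \<and>
     (\<forall>U\<in>Ob T. \<forall>S\<in>Cov T U. \<forall>x.
        (\<forall>f\<in>S. x f \<in> sec F (src T f)) \<and>
        (\<forall>f\<in>S. \<forall>g\<in>Ar T. tgt T g = src T f \<longrightarrow> res F g (x f) = x (cmp T f g)) \<longrightarrow>
        (\<exists>!s. s \<in> sec F U \<and> (\<forall>f\<in>S. res F f s = x f)))"

text \<open>
  Natural transformations. They are normalised to be \<open>undefined\<close> off the carriers, so that
  equality of HOL functions is equality of morphisms.
\<close>

definition Mor :: "('o, 'm) site_data \<Rightarrow> ('o, 'm, 'x) presheaf_data \<Rightarrow> ('o, 'm, 'y) presheaf_data
    \<Rightarrow> ('o \<Rightarrow> 'x \<Rightarrow> 'y) set" where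
  "Mor T F G = {\<eta> \<in> (\<Pi>\<^sub>E U\<in>Ob T. sec F U \<rightarrow>\<^sub>E sec G U).
     \<forall>f\<in>Ar T. \<forall>x\<in>sec F (tgt T f). \<eta> (src T f) (res F f x) = res G f (\<eta> (tgt T f) x)}"

definition prod_sh :: "('o, 'm, 'x) presheaf_data \<Rightarrow> ('o, 'm, 'y) presheaf_data
    \<Rightarrow> ('o, 'm, 'x \<times> 'y) presheaf_data" (infixr \<open>\<times>\<^sub>s\<close> 80) where
  "F \<times>\<^sub>s G = \<lparr>sec = (\<lambda>U. sec F U \<times> sec G U), res = (\<lambda>f (x, y). (res F f x, res G f y))\<rparr>"

record ('o, 'm, 'x) group_sheaf =
  grp :: "'o \<Rightarrow> 'x monoid"
  gres :: "'m \<Rightarrow> 'x \<Rightarrow> 'x"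

definition und :: "('o, 'm, 'x) group_sheaf \<Rightarrow> ('o, 'm, 'x) presheaf_data" where
  "und G = \<lparr>sec = (\<lambda>U. carrier (grp G U)), res = gres G\<rparr>"

definition abelian_group_sheaf :: "('o, 'm) site_data \<Rightarrow> ('o, 'm, 'x) group_sheaf \<Rightarrow> bool" where
  "abelian_group_sheaf T G \<longleftrightarrow> sheaf T (und G) \<and>
     (\<forall>U\<in>Ob T. comm_group (grp G U)) \<and>
     (\<forall>f\<in>Ar T. gres G f \<in> hom (grp G (tgt T f)) (grp G (src T f)))"


section \<open>Torsors and alternating biextensions\<close>

record ('o, 'm, 'a, 'x, 'e) torsor_data =
  Tot :: "('o, 'm, 'e) presheaf_data"
  prj :: "'o \<Rightarrow> 'e \<Rightarrow> 'x"
  act :: "'o \<Rightarrow> 'a \<times> 'e \<Rightarrow> 'e"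

locale topos_groups =
  fixes T :: "('o, 'm) site_data"
    and A :: "('o, 'm, 'a) group_sheaf"
    and B :: "('o, 'm, 'b) group_sheaf"
  assumes site: "site T"
    and abelian_A: "abelian_group_sheaf T A"
    and abelian_B: "abelian_group_sheaf T B"
begin

text \<open>The group law of \<open>A\<close> is written multiplicatively, that of \<open>B\<close> additively.\<close>

abbreviation A_mult :: "'a \<Rightarrow> 'o \<Rightarrow> 'a \<Rightarrow> 'a" (\<open>(_ \<cdot>\<^bsub>_\<^esub> _)\<close> [70, 0, 71] 70) where
  "a \<cdot>\<^bsub>U\<^esub> b \<equiv> mult (grp A U) a b"

abbreviation A_div :: "'a \<Rightarrow> 'o \<Rightarrow> 'a \<Rightarrow> 'a" (\<open>(_ \<^bold>'/\<^bsub>_\<^esub> _)\<close> [70, 0, 71] 70) where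
  "a \<^bold>/\<^bsub>U\<^esub> b \<equiv> mult (grp A U) a (m_inv (grp A U) b)"

abbreviation A_one :: "'o \<Rightarrow> 'a" where
  "A_one U \<equiv> one (grp A U)"

abbreviation B_add :: "'b \<Rightarrow> 'o \<Rightarrow> 'b \<Rightarrow> 'b" (\<open>(_ \<^bold>+\<^bsub>_\<^esub> _)\<close> [65, 0, 66] 65) where
  "x \<^bold>+\<^bsub>U\<^esub> y \<equiv> mult (grp B U) x y"

abbreviation B_neg :: "'o \<Rightarrow> 'b \<Rightarrow> 'b" where
  "B_neg U x \<equiv> m_inv (grp B U) x"

abbreviation B_zero :: "'o \<Rightarrow> 'b" where
  "B_zero U \<equiv> one (grp B U)"

abbreviation A_sec :: "'o \<Rightarrow> 'a set" where
  "A_sec U \<equiv> carrier (grp A U)"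

abbreviation B_sec :: "'o \<Rightarrow> 'b set" where
  "B_sec U \<equiv> carrier (grp B U)"

definition torsor :: "('o, 'm, 'x) presheaf_data \<Rightarrow> ('o, 'm, 'a, 'x, 'e) torsor_data \<Rightarrow> bool" where
  "torsor X E \<longleftrightarrow> sheaf T (Tot E) \<and> prj E \<in> Mor T (Tot E) X \<and>
     act E \<in> Mor T (und A \<times>\<^sub>s Tot E) (Tot E) \<and>
     (\<forall>U\<in>Ob T. \<forall>e\<in>sec (Tot E) U.
        act E U (A_one U, e) = e \<and>
        (\<forall>a\<in>A_sec U. prj E U (act E U (a, e)) = prj E U e) \<and>
        (\<forall>a\<in>A_sec U. \<forall>a'\<in>A_sec U. act E U (a \<cdot>\<^bsub>U\<^esub> a', e) = act E U (a, act E U (a', e))) \<and>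
        (\<forall>e'\<in>sec (Tot E) U. prj E U e = prj E U e' \<longrightarrow> (\<exists>!a. a \<in> A_sec U \<and> act E U (a, e) = e'))) \<and>
     (\<forall>U\<in>Ob T. \<forall>x\<in>sec X U. \<exists>S\<in>Cov T U. \<forall>f\<in>S. \<exists>e\<in>sec (Tot E) (src T f). prj E (src T f) e = res X f x)"

definition fib :: "('o, 'm, 'a, 'b \<times> 'b, 'e) torsor_data \<Rightarrow> 'o \<Rightarrow> 'b \<Rightarrow> 'b \<Rightarrow> 'e set" where
  "fib E U x y = {e \<in> sec (Tot E) U. prj E U e = (x, y)}"

text \<open>
  The class \<open>e\<^sub>1 \<and> \<dots> \<and> e\<^sub>n\<close> in a contracted product of \<open>n\<close> torsors: the set of all
  \<open>(a\<^sub>1 e\<^sub>1, \<dots>, a\<^sub>n e\<^sub>n)\<close> with \<open>a\<^sub>1 \<cdots> a\<^sub>n = 1\<close>.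
\<close>

definition wedge :: "('o, 'm, 'a, 'x, 'e) torsor_data \<Rightarrow> 'o \<Rightarrow> 'e list \<Rightarrow> 'e list set" where
  "wedge E U es = {map2 (\<lambda>a e. act E U (a, e)) as es | as.
     length as = length es \<and> set as \<subseteq> A_sec U \<and> foldr (\<lambda>a b. a \<cdot>\<^bsub>U\<^esub> b) as (A_one U) = A_one U}"

text \<open>
  The domains of the partial laws: pairs with the same second (resp. first) coordinate in \<open>B\<close>.
\<close>

definition dom_law1 :: "('o, 'm, 'a, 'b \<times> 'b, 'e) torsor_data \<Rightarrow> ('o, 'm, 'e \<times> 'e) presheaf_data" where
  "dom_law1 E = (Tot E \<times>\<^sub>s Tot E)\<lparr>sec := \<lambda>U.
     {(e, e'). e \<in> sec (Tot E) U \<and> e' \<in> sec (Tot E) U \<and> snd (prj E U e) = snd (prj E U e')}\<rparr>"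

definition dom_law2 :: "('o, 'm, 'a, 'b \<times> 'b, 'e) torsor_data \<Rightarrow> ('o, 'm, 'e \<times> 'e) presheaf_data" where
  "dom_law2 E = (Tot E \<times>\<^sub>s Tot E)\<lparr>sec := \<lambda>U.
     {(e, e'). e \<in> sec (Tot E) U \<and> e' \<in> sec (Tot E) U \<and> fst (prj E U e) = fst (prj E U e')}\<rparr>"

text \<open>
  A morphism of torsors \<open>E\<^sub>x\<^sub>,\<^sub>y \<and> E\<^sub>x\<^sub>'\<^sub>,\<^sub>y \<rightarrow> E\<^sub>x\<^sub>+\<^sub>x\<^sub>'\<^sub>,\<^sub>y\<close> is the same thing as a map on
  \<open>E\<^sub>x\<^sub>,\<^sub>y \<times> E\<^sub>x\<^sub>'\<^sub>,\<^sub>y\<close> taking \<open>(a e, a' e')\<close> to \<open>a a'\<close> times the image of \<open>(e, e')\<close>; the laws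
  are given in this form.
\<close>

definition biextension :: "('o, 'm, 'a, 'b \<times> 'b, 'e) torsor_data
    \<Rightarrow> ('o \<Rightarrow> 'e \<times> 'e \<Rightarrow> 'e) \<Rightarrow> ('o \<Rightarrow> 'e \<times> 'e \<Rightarrow> 'e) \<Rightarrow> bool" where
  "biextension E P1 P2 \<longleftrightarrow>
     torsor (und B \<times>\<^sub>s und B) E \<and>
     P1 \<in> Mor T (dom_law1 E) (Tot E) \<and> P2 \<in> Mor T (dom_law2 E) (Tot E) \<and>
     (\<forall>U\<in>Ob T. \<forall>x\<in>B_sec U. \<forall>x'\<in>B_sec U. \<forall>y\<in>B_sec U. \<forall>e\<in>fib E U x y. \<forall>e'\<in>fib E U x' y.
        P1 U (e, e') \<in> fib E U (x \<^bold>+\<^bsub>U\<^esub> x') y \<and>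
        (\<forall>a\<in>A_sec U. \<forall>a'\<in>A_sec U.
           P1 U (act E U (a, e), act E U (a', e')) = act E U (a \<cdot>\<^bsub>U\<^esub> a', P1 U (e, e')))) \<and>
     (\<forall>U\<in>Ob T. \<forall>x\<in>B_sec U. \<forall>y\<in>B_sec U. \<forall>y'\<in>B_sec U. \<forall>e\<in>fib E U x y. \<forall>e'\<in>fib E U x y'.
        P2 U (e, e') \<in> fib E U x (y \<^bold>+\<^bsub>U\<^esub> y') \<and>
        (\<forall>a\<in>A_sec U. \<forall>a'\<in>A_sec U.
           P2 U (act E U (a, e), act E U (a', e')) = act E U (a \<cdot>\<^bsub>U\<^esub> a', P2 U (e, e')))) \<and>
     (\<forall>U\<in>Ob T. \<forall>x\<in>B_sec U. \<forall>x'\<in>B_sec U. \<forall>x''\<in>B_sec U. \<forall>y\<in>B_sec U.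
        \<forall>e\<in>fib E U x y. \<forall>e'\<in>fib E U x' y. \<forall>e''\<in>fib E U x'' y.
        P1 U (P1 U (e, e'), e'') = P1 U (e, P1 U (e', e'')) \<and> P1 U (e, e') = P1 U (e', e)) \<and>
     (\<forall>U\<in>Ob T. \<forall>x\<in>B_sec U. \<forall>y\<in>B_sec U. \<forall>y'\<in>B_sec U. \<forall>y''\<in>B_sec U.
        \<forall>e\<in>fib E U x y. \<forall>e'\<in>fib E U x y'. \<forall>e''\<in>fib E U x y''.
        P2 U (P2 U (e, e'), e'') = P2 U (e, P2 U (e', e'')) \<and> P2 U (e, e') = P2 U (e', e)) \<and>
     (\<forall>U\<in>Ob T. \<forall>x\<in>B_sec U. \<forall>x'\<in>B_sec U. \<forall>y\<in>B_sec U. \<forall>y'\<in>B_sec U.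
        \<forall>a\<in>fib E U x y. \<forall>b\<in>fib E U x' y. \<forall>c\<in>fib E U x y'. \<forall>d\<in>fib E U x' y'.
        P2 U (P1 U (a, b), P1 U (c, d)) = P1 U (P2 U (a, c), P2 U (b, d)))"

text \<open>
  The isomorphism \<open>E\<^sub>x\<^sub>,\<^sub>x \<and> E\<^sub>x\<^sub>,\<^sub>y \<and> E\<^sub>y\<^sub>,\<^sub>x \<and> E\<^sub>y\<^sub>,\<^sub>y \<rightarrow> E\<^sub>x\<^sub>+\<^sub>y\<^sub>,\<^sub>x\<^sub>+\<^sub>y\<close> and its analogue for three summands.
\<close>

definition sum4 :: "('o \<Rightarrow> 'e \<times> 'e \<Rightarrow> 'e) \<Rightarrow> ('o \<Rightarrow> 'e \<times> 'e \<Rightarrow> 'e) \<Rightarrow> 'o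
    \<Rightarrow> 'e \<Rightarrow> 'e \<Rightarrow> 'e \<Rightarrow> 'e \<Rightarrow> 'e" where
  "sum4 P1 P2 U exx exy eyx eyy = P1 U (P2 U (exx, exy), P2 U (eyx, eyy))"

definition sum9 :: "('o \<Rightarrow> 'e \<times> 'e \<Rightarrow> 'e) \<Rightarrow> ('o \<Rightarrow> 'e \<times> 'e \<Rightarrow> 'e) \<Rightarrow> 'o
    \<Rightarrow> 'e \<Rightarrow> 'e \<Rightarrow> 'e \<Rightarrow> 'e \<Rightarrow> 'e \<Rightarrow> 'e \<Rightarrow> 'e \<Rightarrow> 'e \<Rightarrow> 'e \<Rightarrow> 'e" where
  "sum9 P1 P2 U exx exy exz eyx eyy eyz ezx ezy ezz =
     P1 U (P1 U (P2 U (P2 U (exx, exy), exz), P2 U (P2 U (eyx, eyy), eyz)),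
           P2 U (P2 U (ezx, ezy), ezz))"

text \<open>
  The graph of \<open>\<sigma>\<^sub>x\<close> on sections over \<open>U\<close>. It is the composite
  \<open>E\<^sub>-\<^sub>x\<^sub>,\<^sub>-\<^sub>x \<simeq> (E\<^sub>x\<^sub>,\<^sub>-\<^sub>x)\<inverse> \<simeq> E\<^sub>x\<^sub>,\<^sub>x\<close>, where the first isomorphism comes from the first law and the
  trivialization of \<open>E\<^sub>0\<^sub>,\<^sub>-\<^sub>x\<close> by its neutral section, the second from the second law and the
  neutral section of \<open>E\<^sub>x\<^sub>,\<^sub>0\<close>; \<open>c\<close> is an auxiliary section of \<open>E\<^sub>x\<^sub>,\<^sub>-\<^sub>x\<close>. (Passing through
  \<open>E\<^sub>-\<^sub>x\<^sub>,\<^sub>x\<close> gives the same isomorphism, by compatibility of the laws.)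
\<close>

definition sigma_graph :: "('o, 'm, 'a, 'b \<times> 'b, 'e) torsor_data
    \<Rightarrow> ('o \<Rightarrow> 'e \<times> 'e \<Rightarrow> 'e) \<Rightarrow> ('o \<Rightarrow> 'e \<times> 'e \<Rightarrow> 'e) \<Rightarrow> 'o \<Rightarrow> 'b \<Rightarrow> ('e \<times> 'e) set" where
  "sigma_graph E P1 P2 U x =
     {(a, d). a \<in> fib E U (B_neg U x) (B_neg U x) \<and> d \<in> fib E U x x \<and>
        (\<exists>c\<in>fib E U x (B_neg U x). \<exists>e1\<in>fib E U (B_zero U) (B_neg U x). \<exists>e2\<in>fib E U x (B_zero U).
           P1 U (e1, e1) = e1 \<and> P2 U (e2, e2) = e2 \<and>
           (\<exists>\<alpha>\<in>A_sec U. P1 U (a, c) = act E U (\<alpha>, e1) \<and> P2 U (c, d) = act E U (\<alpha>, e2)))}"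

text \<open>
  The graph of the cube structure
  \<open>\<Delta>E\<^sub>x\<^sub>+\<^sub>y\<^sub>+\<^sub>z \<and> \<Delta>E\<^sub>x \<and> \<Delta>E\<^sub>y \<and> \<Delta>E\<^sub>z \<simeq> \<Delta>E\<^sub>x\<^sub>+\<^sub>y \<and> \<Delta>E\<^sub>x\<^sub>+\<^sub>z \<and> \<Delta>E\<^sub>y\<^sub>+\<^sub>z\<close>,
  obtained by decomposing both sides into the same twelve factors, each of
  \<open>E\<^sub>x\<^sub>,\<^sub>x\<close>, \<open>E\<^sub>y\<^sub>,\<^sub>y\<close>, \<open>E\<^sub>z\<^sub>,\<^sub>z\<close> occurring twice (\<open>exx\<close> and \<open>nx\<close>, etc.).
\<close>

definition cube_graph :: "('o, 'm, 'a, 'b \<times> 'b, 'e) torsor_data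
    \<Rightarrow> ('o \<Rightarrow> 'e \<times> 'e \<Rightarrow> 'e) \<Rightarrow> ('o \<Rightarrow> 'e \<times> 'e \<Rightarrow> 'e) \<Rightarrow> 'o \<Rightarrow> 'b \<Rightarrow> 'b \<Rightarrow> 'b
    \<Rightarrow> ('e list set \<times> 'e list set) set" where
  "cube_graph E P1 P2 U x y z =
     {(wedge E U [sum9 P1 P2 U exx exy exz eyx eyy eyz ezx ezy ezz, nx, ny, nz],
       wedge E U [sum4 P1 P2 U exx exy eyx eyy, sum4 P1 P2 U nx exz ezx ezz, sum4 P1 P2 U ny eyz ezy nz])
      | exx exy exz eyx eyy eyz ezx ezy ezz nx ny nz.
        exx \<in> fib E U x x \<and> exy \<in> fib E U x y \<and> exz \<in> fib E U x z \<and>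
        eyx \<in> fib E U y x \<and> eyy \<in> fib E U y y \<and> eyz \<in> fib E U y z \<and>
        ezx \<in> fib E U z x \<and> ezy \<in> fib E U z y \<and> ezz \<in> fib E U z z \<and>
        nx \<in> fib E U x x \<and> ny \<in> fib E U y y \<and> nz \<in> fib E U z z}"

text \<open>
  For a general torsor the auxiliary sections appearing in the two graphs exist only locally; the
  compatibilities of \<open>t\<close> are therefore required on a covering (equivalently, for the induced
  isomorphisms of sheaves).
\<close>

definition alternating_biextension :: "('o, 'm, 'a, 'b \<times> 'b, 'e) torsor_data
    \<Rightarrow> ('o \<Rightarrow> 'e \<times> 'e \<Rightarrow> 'e) \<Rightarrow> ('o \<Rightarrow> 'e \<times> 'e \<Rightarrow> 'e) \<Rightarrow> ('o \<Rightarrow> 'b \<Rightarrow> 'e) \<Rightarrow> bool" where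
  "alternating_biextension E P1 P2 t \<longleftrightarrow>
     biextension E P1 P2 \<and>
     t \<in> Mor T (und B) (Tot E) \<and> (\<forall>U\<in>Ob T. \<forall>x\<in>B_sec U. t U x \<in> fib E U x x) \<and>
     (\<forall>U\<in>Ob T. \<forall>x\<in>B_sec U. \<exists>S\<in>Cov T U. \<forall>f\<in>S.
        let V = src T f; x' = gres B f x
        in (t V (B_neg V x'), t V x') \<in> sigma_graph E P1 P2 V x') \<and>
     (\<forall>U\<in>Ob T. \<forall>x\<in>B_sec U. \<forall>y\<in>B_sec U. \<forall>z\<in>B_sec U. \<exists>S\<in>Cov T U. \<forall>f\<in>S.
        let V = src T f; x' = gres B f x; y' = gres B f y; z' = gres B f z
        in (wedge E V [t V (x' \<^bold>+\<^bsub>V\<^esub> y' \<^bold>+\<^bsub>V\<^esub> z'), t V x', t V y', t V z'],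
            wedge E V [t V (x' \<^bold>+\<^bsub>V\<^esub> y'), t V (x' \<^bold>+\<^bsub>V\<^esub> z'), t V (y' \<^bold>+\<^bsub>V\<^esub> z')])
           \<in> cube_graph E P1 P2 V x' y' z')"

text \<open>
  The value at \<open>(x, y)\<close> of the anti-symmetry section \<open>\<pi>\<close>, i.e. the image of
  \<open>t(x+y) \<and> t(x)\<inverse> \<and> t(y)\<inverse>\<close>, as a class in \<open>E\<^sub>x\<^sub>,\<^sub>y \<and> E\<^sub>y\<^sub>,\<^sub>x\<close>: the set of its representatives.
\<close>

definition antisym :: "('o, 'm, 'a, 'b \<times> 'b, 'e) torsor_data
    \<Rightarrow> ('o \<Rightarrow> 'e \<times> 'e \<Rightarrow> 'e) \<Rightarrow> ('o \<Rightarrow> 'e \<times> 'e \<Rightarrow> 'e) \<Rightarrow> ('o \<Rightarrow> 'b \<Rightarrow> 'e)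
    \<Rightarrow> 'o \<Rightarrow> 'b \<Rightarrow> 'b \<Rightarrow> 'e list set" where
  "antisym E P1 P2 t U x y = {[exy, eyx] | exy eyx. exy \<in> fib E U x y \<and> eyx \<in> fib E U y x \<and>
     t U (x \<^bold>+\<^bsub>U\<^esub> y) = sum4 P1 P2 U (t U x) exy eyx (t U y)}"

definition trivialization :: "('o, 'm, 'a, 'b \<times> 'b, 'e) torsor_data
    \<Rightarrow> ('o \<Rightarrow> 'e \<times> 'e \<Rightarrow> 'e) \<Rightarrow> ('o \<Rightarrow> 'e \<times> 'e \<Rightarrow> 'e) \<Rightarrow> ('o \<Rightarrow> 'b \<Rightarrow> 'e)
    \<Rightarrow> ('o \<Rightarrow> 'b \<times> 'b \<Rightarrow> 'e) \<Rightarrow> bool" where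
  "trivialization E P1 P2 t s \<longleftrightarrow>
     s \<in> Mor T (und B \<times>\<^sub>s und B) (Tot E) \<and>
     (\<forall>U\<in>Ob T. \<forall>x\<in>B_sec U. \<forall>y\<in>B_sec U. s U (x, y) \<in> fib E U x y) \<and>
     (\<forall>U\<in>Ob T. \<forall>x\<in>B_sec U. \<forall>x'\<in>B_sec U. \<forall>y\<in>B_sec U.
        s U (x \<^bold>+\<^bsub>U\<^esub> x', y) = P1 U (s U (x, y), s U (x', y))) \<and>
     (\<forall>U\<in>Ob T. \<forall>x\<in>B_sec U. \<forall>y\<in>B_sec U. \<forall>y'\<in>B_sec U.
        s U (x, y \<^bold>+\<^bsub>U\<^esub> y') = P2 U (s U (x, y), s U (x, y'))) \<and>
     (\<forall>U\<in>Ob T. \<forall>x\<in>B_sec U. s U (x, x) = t U x)"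


section \<open>The trivial torsor and the maps g, h, \<phi>, u, k\<close>

definition trivial_torsor :: "('o, 'm, 'a, 'b \<times> 'b, 'a \<times> 'b \<times> 'b) torsor_data" where
  "trivial_torsor = \<lparr>Tot = und A \<times>\<^sub>s und B \<times>\<^sub>s und B,
     prj = (\<lambda>U\<in>Ob T. \<lambda>e\<in>A_sec U \<times> B_sec U \<times> B_sec U. snd e),
     act = (\<lambda>U\<in>Ob T. \<lambda>(a, e)\<in>A_sec U \<times> A_sec U \<times> B_sec U \<times> B_sec U. (a \<cdot>\<^bsub>U\<^esub> fst e, snd e))\<rparr>"

definition lam :: "('o \<Rightarrow> 'b \<times> 'b \<times> 'b \<Rightarrow> 'a) \<Rightarrow> ('o \<Rightarrow> 'b \<times> 'b \<times> 'b \<Rightarrow> 'a) \<Rightarrow> 'o \<Rightarrow> 'b \<Rightarrow> 'b \<Rightarrow> 'a" where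
  "lam g h U b1 b2 = g U (b1, b2, b1 \<^bold>+\<^bsub>U\<^esub> b2) \<cdot>\<^bsub>U\<^esub> h U (b1, b1, b2) \<cdot>\<^bsub>U\<^esub> h U (b2, b1, b2)"

definition quadruples :: "(('o \<Rightarrow> 'b \<times> 'b \<times> 'b \<Rightarrow> 'a) \<times> ('o \<Rightarrow> 'b \<times> 'b \<times> 'b \<Rightarrow> 'a) \<times>
    ('o \<Rightarrow> 'b \<times> 'b \<Rightarrow> 'a) \<times> ('o \<Rightarrow> 'b \<Rightarrow> 'a)) set" where
  "quadruples = {(g, h, \<phi>, u).
     g \<in> Mor T (und B \<times>\<^sub>s und B \<times>\<^sub>s und B) (und A) \<and>
     h \<in> Mor T (und B \<times>\<^sub>s und B \<times>\<^sub>s und B) (und A) \<and>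
     \<phi> \<in> Mor T (und B \<times>\<^sub>s und B) (und A) \<and>
     u \<in> Mor T (und B) (und A) \<and>
     (\<forall>U\<in>Ob T. \<forall>b1\<in>B_sec U. \<forall>b2\<in>B_sec U. \<forall>b3\<in>B_sec U. \<forall>b'\<in>B_sec U.
        g U (b2, b3, b') \<cdot>\<^bsub>U\<^esub> g U (b1, b2 \<^bold>+\<^bsub>U\<^esub> b3, b') = g U (b1 \<^bold>+\<^bsub>U\<^esub> b2, b3, b') \<cdot>\<^bsub>U\<^esub> g U (b1, b2, b')) \<and>
     (\<forall>U\<in>Ob T. \<forall>b\<in>B_sec U. \<forall>b1'\<in>B_sec U. \<forall>b2'\<in>B_sec U. \<forall>b3'\<in>B_sec U.
        h U (b, b2', b3') \<cdot>\<^bsub>U\<^esub> h U (b, b1', b2' \<^bold>+\<^bsub>U\<^esub> b3') = h U (b, b1' \<^bold>+\<^bsub>U\<^esub> b2', b3') \<cdot>\<^bsub>U\<^esub> h U (b, b1', b2')) \<and>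
     (\<forall>U\<in>Ob T. \<forall>b1\<in>B_sec U. \<forall>b2\<in>B_sec U. \<forall>b'\<in>B_sec U. g U (b1, b2, b') = g U (b2, b1, b')) \<and>
     (\<forall>U\<in>Ob T. \<forall>b\<in>B_sec U. \<forall>b1'\<in>B_sec U. \<forall>b2'\<in>B_sec U. h U (b, b1', b2') = h U (b, b2', b1')) \<and>
     (\<forall>U\<in>Ob T. \<forall>b1\<in>B_sec U. \<forall>b2\<in>B_sec U. \<forall>b1'\<in>B_sec U. \<forall>b2'\<in>B_sec U.
        h U (b1 \<^bold>+\<^bsub>U\<^esub> b2, b1', b2') \<^bold>/\<^bsub>U\<^esub> (h U (b1, b1', b2') \<cdot>\<^bsub>U\<^esub> h U (b2, b1', b2')) =
        g U (b1, b2, b1' \<^bold>+\<^bsub>U\<^esub> b2') \<^bold>/\<^bsub>U\<^esub> (g U (b1, b2, b1') \<cdot>\<^bsub>U\<^esub> g U (b1, b2, b2'))) \<and>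
     (\<forall>U\<in>Ob T. \<forall>b1\<in>B_sec U. \<forall>b2\<in>B_sec U. \<forall>b'\<in>B_sec U.
        \<phi> U (b1 \<^bold>+\<^bsub>U\<^esub> b2, b') \<^bold>/\<^bsub>U\<^esub> (\<phi> U (b1, b') \<cdot>\<^bsub>U\<^esub> \<phi> U (b2, b')) = g U (b1, b2, b') \<cdot>\<^bsub>U\<^esub> h U (b', b1, b2)) \<and>
     (\<forall>U\<in>Ob T. \<forall>b\<in>B_sec U. \<forall>b1'\<in>B_sec U. \<forall>b2'\<in>B_sec U.
        \<phi> U (b, b1' \<^bold>+\<^bsub>U\<^esub> b2') \<^bold>/\<^bsub>U\<^esub> (\<phi> U (b, b1') \<cdot>\<^bsub>U\<^esub> \<phi> U (b, b2')) = h U (b, b1', b2') \<cdot>\<^bsub>U\<^esub> g U (b1', b2', b)) \<and>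
     (\<forall>U\<in>Ob T. \<forall>b\<in>B_sec U. \<forall>b'\<in>B_sec U. \<phi> U (b, b') = \<phi> U (b', b)) \<and>
     (\<forall>U\<in>Ob T. \<forall>b\<in>B_sec U. \<forall>b'\<in>B_sec U.
        lam g h U b b' \<cdot>\<^bsub>U\<^esub> \<phi> U (b, b') = u U (b \<^bold>+\<^bsub>U\<^esub> b') \<^bold>/\<^bsub>U\<^esub> (u U b \<cdot>\<^bsub>U\<^esub> u U b')) \<and>
     (\<forall>U\<in>Ob T. \<forall>b\<in>B_sec U. u U b \<cdot>\<^bsub>U\<^esub> u U b = \<phi> U (b, b))}"

text \<open>
  The quadruple describes the structure on the trivial torsor. The class \<open>\<pi>(x, y)\<close> is written
  \<open>\<phi>(x, y)\<close> times the base point \<open>(1, x, y) \<and> (1, y, x)\<close> of \<open>E\<^sub>x\<^sub>,\<^sub>y \<and> E\<^sub>y\<^sub>,\<^sub>x\<close>.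
\<close>

fun describes where
  "describes (P1, P2, t) (g, h, \<phi>, u) \<longleftrightarrow>
     (\<forall>U\<in>Ob T. \<forall>a1\<in>A_sec U. \<forall>a2\<in>A_sec U. \<forall>b1\<in>B_sec U. \<forall>b2\<in>B_sec U. \<forall>b'\<in>B_sec U.
        P1 U ((a1, b1, b'), (a2, b2, b')) = (a1 \<cdot>\<^bsub>U\<^esub> a2 \<cdot>\<^bsub>U\<^esub> g U (b1, b2, b'), b1 \<^bold>+\<^bsub>U\<^esub> b2, b')) \<and>
     (\<forall>U\<in>Ob T. \<forall>a1\<in>A_sec U. \<forall>a2\<in>A_sec U. \<forall>b\<in>B_sec U. \<forall>b1'\<in>B_sec U. \<forall>b2'\<in>B_sec U.
        P2 U ((a1, b, b1'), (a2, b, b2')) = (a1 \<cdot>\<^bsub>U\<^esub> a2 \<cdot>\<^bsub>U\<^esub> h U (b, b1', b2'), b, b1' \<^bold>+\<^bsub>U\<^esub> b2')) \<and>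
     (\<forall>U\<in>Ob T. \<forall>x\<in>B_sec U. \<forall>y\<in>B_sec U.
        antisym trivial_torsor P1 P2 t U x y = wedge trivial_torsor U [(\<phi> U (x, y), x, y), (A_one U, y, x)]) \<and>
     (\<forall>U\<in>Ob T. \<forall>x\<in>B_sec U. t U x = (u U x, x, x))"

fun trivializing_maps where
  "trivializing_maps (g, h, \<phi>, u) = {k \<in> Mor T (und B \<times>\<^sub>s und B) (und A).
     (\<forall>U\<in>Ob T. \<forall>b1\<in>B_sec U. \<forall>b2\<in>B_sec U. \<forall>b'\<in>B_sec U.
        g U (b1, b2, b') = k U (b1 \<^bold>+\<^bsub>U\<^esub> b2, b') \<^bold>/\<^bsub>U\<^esub> (k U (b1, b') \<cdot>\<^bsub>U\<^esub> k U (b2, b'))) \<and>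
     (\<forall>U\<in>Ob T. \<forall>b\<in>B_sec U. \<forall>b1'\<in>B_sec U. \<forall>b2'\<in>B_sec U.
        h U (b, b1', b2') = k U (b, b1' \<^bold>+\<^bsub>U\<^esub> b2') \<^bold>/\<^bsub>U\<^esub> (k U (b, b1') \<cdot>\<^bsub>U\<^esub> k U (b, b2'))) \<and>
     (\<forall>U\<in>Ob T. \<forall>x\<in>B_sec U. k U (x, x) = u U x) \<and>
     (\<forall>U\<in>Ob T. \<forall>x\<in>B_sec U. \<forall>y\<in>B_sec U. k U (x, y) \<cdot>\<^bsub>U\<^esub> k U (y, x) = \<phi> U (x, y))}"

definition section_describes :: "('o \<Rightarrow> 'b \<times> 'b \<Rightarrow> 'a \<times> 'b \<times> 'b) \<Rightarrow> ('o \<Rightarrow> 'b \<times> 'b \<Rightarrow> 'a) \<Rightarrow> bool" where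
  "section_describes s k \<longleftrightarrow> (\<forall>U\<in>Ob T. \<forall>x\<in>B_sec U. \<forall>y\<in>B_sec U. s U (x, y) = (k U (x, y), x, y))"

definition alternating_structures where
  "alternating_structures E = {(P1, P2, t). alternating_biextension E P1 P2 t}"

fun trivializations where
  "trivializations E (P1, P2, t) = {s. trivialization E P1 P2 t s}"

end

end

theory Submission
  imports Defs
begin

text \<open>
  On the trivial torsor all auxiliary sections exist globally, and equations between sections of \<open>A\<close>
  may be checked locally. Hence the structure unwinds, over each object \<open>U\<close> separately, into equations
  in the abelian group \<open>A(U)\<close>. The axioms of a biextension become (1)--(3), and \<open>\<phi>\<close> is defined
  by (6). Given (1)--(3) and (6), the compatibility of \<open>t\<close> with the cube structure at \<open>(x, y, z)\<close> is
  equivalent to the first half of (4), because the \<open>u\<close>-terms cancel and one instance of (3) remains;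
  symmetry of \<open>\<lambda>\<close> gives (5) and then the second half of (4). Given (4), expanding
  \<open>\<phi>(x, x + (-x))\<close> turns the compatibility of \<open>t\<close> with \<open>\<sigma>\<^sub>x\<close> into (7).
\<close>

section \<open>Alternating cocycles over one object\<close>

text \<open>Data and axioms are kept apart. Over the trivial torsor, two equivariant laws and a
  section of \<Delta>E amount to a triple \<open>(g, h, u)\<close> of maps before any axiom is
  imposed, and (6) says exactly that \<open>\<phi>\<close> describes the class \<pi>. A single
  equivalence, between the axioms of an alternating biextension and those of a quadruple linked to
  it by \<open>describes\<close>, therefore serves both directions of the correspondence; what
  remains is to pass between laws or sections and maps.

  The difficulty is that the base points \<open>(1, x, y)\<close> respect neither law and that the
  cocycles are not assumed normalised at zero. Sums of base points leave the factors
  \<open>lam2\<close> and \<open>lam3\<close>, and the neutral sections entering \<sigma> leave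
  values such as g(0, 0; -x) and h(x; 0, 0). These values cannot be set to 1. They are removed by
  instances of (3) with zero arguments and by applying (4) and (6) to 0 + 0 = 0.\<close>

lemma (in comm_group) div_eq_iff:
  assumes "a \<in> carrier G" "b \<in> carrier G" "c \<in> carrier G"
  shows "a \<otimes> inv b = c \<longleftrightarrow> a = c \<otimes> b"
  using assms by (metis inv_closed inv_solve_right inv_inv)

text \<open>\<open>L\<close> and \<open>R\<close> are variables so that a caller names only the
  common factor \<open>K\<close>; splitting it off on either side is then a goal for AC
  rewriting.\<close>

lemma (in comm_group) cancel_iff:
  assumes "K \<in> carrier G" "a \<in> carrier G" "b \<in> carrier G" "L = K \<otimes> a" "R = K \<otimes> b"
  shows "L = R \<longleftrightarrow> a = b"
  using assms by simp

text \<open>Only closure is assumed, so that \<open>lam2\<close> and \<open>lam3\<close> make sense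
  before the laws are known to satisfy any axiom.\<close>

locale law_pair = A: comm_group A + B: comm_group B
  for A :: "('a, 'c) monoid_scheme" (structure) and B :: "('b, 'd) monoid_scheme" +
  fixes g h :: "'b \<times> 'b \<times> 'b \<Rightarrow> 'a"
  assumes g_closed [simp]: "\<lbrakk>x \<in> carrier B; y \<in> carrier B; z \<in> carrier B\<rbrakk> \<Longrightarrow> g (x, y, z) \<in> carrier A"
    and h_closed [simp]: "\<lbrakk>x \<in> carrier B; y \<in> carrier B; z \<in> carrier B\<rbrakk> \<Longrightarrow> h (x, y, z) \<in> carrier A"
begin

text \<open>The \<open>A\<close>-component of \<open>sum4\<close> at the four base points over (x,
  x), (x, y), (y, x), (y, y). It measures the failure of the base points to respect the
  decomposition along x + y.\<close>

definition lam2 :: "'b \<Rightarrow> 'b \<Rightarrow> 'a" where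
  "lam2 x y = g (x, y, x \<otimes>\<^bsub>B\<^esub> y) \<otimes> h (x, x, y) \<otimes> h (y, x, y)"

text \<open>The \<open>A\<close>-component of \<open>sum9\<close> at nine base points, in the
  bracketing of \<open>sum9\<close>: each row is added by the second law, giving values of
  \<open>h\<close>, then the rows by the first, giving values of \<open>g\<close>.\<close>

definition lam3 :: "'b \<Rightarrow> 'b \<Rightarrow> 'b \<Rightarrow> 'a" where
  "lam3 x y z = (h (x, x, y) \<otimes> h (x, x \<otimes>\<^bsub>B\<^esub> y, z)) \<otimes> (h (y, x, y) \<otimes> h (y, x \<otimes>\<^bsub>B\<^esub> y, z))
     \<otimes> g (x, y, x \<otimes>\<^bsub>B\<^esub> y \<otimes>\<^bsub>B\<^esub> z) \<otimes> (h (z, x, y) \<otimes> h (z, x \<otimes>\<^bsub>B\<^esub> y, z))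
     \<otimes> g (x \<otimes>\<^bsub>B\<^esub> y, z, x \<otimes>\<^bsub>B\<^esub> y \<otimes>\<^bsub>B\<^esub> z)"

lemma lam2_closed [simp]: "\<lbrakk>x \<in> carrier B; y \<in> carrier B\<rbrakk> \<Longrightarrow> lam2 x y \<in> carrier A"
  by (simp add: lam2_def)

lemma lam3_closed [simp]:
  "\<lbrakk>x \<in> carrier B; y \<in> carrier B; z \<in> carrier B\<rbrakk> \<Longrightarrow> lam3 x y z \<in> carrier A"
  by (simp add: lam3_def)

end

text \<open>The fractions in (3) and (6) are cleared, so no inverses in \<open>A\<close> enter the
  computations. Conditions (4) and (7) are not assumed, because they are what the cube and symmetry
  conditions are to be compared with.\<close>

locale alternating_pair = law_pair A B g h
  for A :: "('a, 'c) monoid_scheme" (structure) and B :: "('b, 'd) monoid_scheme" and g h +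
  fixes \<phi> :: "'b \<times> 'b \<Rightarrow> 'a" and u :: "'b \<Rightarrow> 'a"
  assumes phi_closed [simp]: "\<lbrakk>x \<in> carrier B; y \<in> carrier B\<rbrakk> \<Longrightarrow> \<phi> (x, y) \<in> carrier A"
    and u_closed [simp]: "x \<in> carrier B \<Longrightarrow> u x \<in> carrier A"
    and g_commute: "\<lbrakk>x \<in> carrier B; y \<in> carrier B; z \<in> carrier B\<rbrakk> \<Longrightarrow> g (x, y, z) = g (y, x, z)"
    and h_commute: "\<lbrakk>x \<in> carrier B; y \<in> carrier B; z \<in> carrier B\<rbrakk> \<Longrightarrow> h (x, y, z) = h (x, z, y)"
    and interchange: "\<lbrakk>x \<in> carrier B; x' \<in> carrier B; y \<in> carrier B; y' \<in> carrier B\<rbrakk> \<Longrightarrow>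
      h (x \<otimes>\<^bsub>B\<^esub> x', y, y') \<otimes> (g (x, x', y) \<otimes> g (x, x', y'))
      = g (x, x', y \<otimes>\<^bsub>B\<^esub> y') \<otimes> (h (x, y, y') \<otimes> h (x', y, y'))"
    and u_add: "\<lbrakk>x \<in> carrier B; y \<in> carrier B\<rbrakk> \<Longrightarrow>
      u (x \<otimes>\<^bsub>B\<^esub> y) = lam2 x y \<otimes> \<phi> (x, y) \<otimes> (u x \<otimes> u y)"
begin

text \<open>Swapping x and y exchanges the two \<open>h\<close> factors, and (2) restores the order
  of the arguments in each factor.\<close>

lemma lam2_commute: "\<lbrakk>x \<in> carrier B; y \<in> carrier B\<rbrakk> \<Longrightarrow> lam2 x y = lam2 y x"
  unfolding lam2_def
  by (simp add: g_commute [of x y] h_commute [of _ x y] B.m_comm [of x y] A.m_ac)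

text \<open>By (6), \<open>\<phi> (x, y)\<close> is the quotient of u(x + y) by
  \<open>lam2 x y\<close>, u(x) and u(y), an expression symmetric in x and y.\<close>

lemma phi_commute:
  assumes "x \<in> carrier B" "y \<in> carrier B"
  shows "\<phi> (x, y) = \<phi> (y, x)"
proof -
  have "lam2 x y \<otimes> (u x \<otimes> u y) \<otimes> \<phi> (x, y) = lam2 x y \<otimes> (u x \<otimes> u y) \<otimes> \<phi> (y, x)"
    using assms u_add [of x y] u_add [of y x] by (simp add: A.m_ac lam2_commute [of y x] B.m_comm [of y x])
  then show ?thesis using assms by simp
qed

text \<open>The value u(x + y) occurs on both sides once u((x + y) + z) is expanded, so it stays
  unexpanded. Applying (6) to (x + y) + z, x + z and y + z brings in \<open>\<phi>\<close> at
  exactly the three arguments of the claim.\<close>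

lemma cube_iff_phi_add:
  assumes x: "x \<in> carrier B" and y: "y \<in> carrier B" and z: "z \<in> carrier B"
  shows "u (x \<otimes>\<^bsub>B\<^esub> y \<otimes>\<^bsub>B\<^esub> z) \<otimes> u x \<otimes> u y \<otimes> u z \<otimes> (lam2 x y \<otimes> lam2 x z \<otimes> lam2 y z)
      = u (x \<otimes>\<^bsub>B\<^esub> y) \<otimes> u (x \<otimes>\<^bsub>B\<^esub> z) \<otimes> u (y \<otimes>\<^bsub>B\<^esub> z) \<otimes> lam3 x y z
    \<longleftrightarrow> \<phi> (x \<otimes>\<^bsub>B\<^esub> y, z) = g (x, y, z) \<otimes> h (z, x, y) \<otimes> (\<phi> (x, z) \<otimes> \<phi> (y, z))"
    (is "?L = ?R \<longleftrightarrow> ?f = ?g \<otimes> ?h \<otimes> (?fx \<otimes> ?fy)")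
proof -
  let ?xy = "x \<otimes>\<^bsub>B\<^esub> y"
  let ?xyz = "?xy \<otimes>\<^bsub>B\<^esub> z"
  note xyz [simp] = x y z
  \<comment> \<open>\<open>?M\<close> collects the \<open>u\<close> and \<open>lam2\<close> factors
    common to both sides; u(z) appears twice because the right side has it from both x + z and y +
    z. \<open>?k\<close> collects the values of \<open>g\<close> and \<open>h\<close> that
    \<open>lam3 x y z\<close> shares with \<open>lam2 x y\<close> and
    \<open>lam2 (x + y) z\<close>.\<close>
  let ?k = "h (x, x, y) \<otimes> (h (y, x, y) \<otimes> (h (z, ?xy, z) \<otimes> g (?xy, z, ?xyz)))"
  let ?M = "u ?xy \<otimes> (u x \<otimes> (u y \<otimes> (u z \<otimes> (u z \<otimes> (lam2 x z \<otimes> lam2 y z)))))"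
  let ?l = "h (?xy, ?xy, z) \<otimes> (g (x, y, ?xy) \<otimes> ?f)"
  let ?r = "g (x, y, ?xyz) \<otimes> h (x, ?xy, z) \<otimes> h (y, ?xy, z) \<otimes> (?h \<otimes> ?fx \<otimes> ?fy)"
  have "?L = ?M \<otimes> ?k \<otimes> ?l"
    unfolding u_add [OF B.m_closed [OF x y] z]
    by (simp add: lam2_def [of x y] lam2_def [of ?xy z] A.m_ac)
  moreover have "?R = ?M \<otimes> ?k \<otimes> ?r"
    unfolding u_add [OF x z] u_add [OF y z] by (simp add: lam3_def A.m_ac)
  ultimately have "?L = ?R \<longleftrightarrow> ?l = ?r" by simp
  \<comment> \<open>The factor g(x, y; z) completes the left side of (3) at the arguments x, y and x
    + y, z.\<close>
  also have "\<dots> \<longleftrightarrow> ?g \<otimes> ?l = ?g \<otimes> ?r" by simp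
  also have "?g \<otimes> ?l = h (?xy, ?xy, z) \<otimes> (g (x, y, ?xy) \<otimes> ?g) \<otimes> ?f"
    by (simp add: A.m_ac)
  also have "\<dots> = g (x, y, ?xyz) \<otimes> (h (x, ?xy, z) \<otimes> h (y, ?xy, z)) \<otimes> ?f"
    by (simp add: interchange)
  also have "?g \<otimes> ?r = g (x, y, ?xyz) \<otimes> (h (x, ?xy, z) \<otimes> h (y, ?xy, z)) \<otimes> (?g \<otimes> ?h \<otimes> (?fx \<otimes> ?fy))"
    by (simp add: A.m_ac)
  finally show ?thesis by simp
qed

text \<open>With m = -x, additivity in the second variable writes \<phi>(x, 0) through \<phi>(x, x)
  and \<phi>(x, m), while (6) writes u(0) through \<phi>(x, m), u(x) and u(m). Eliminating \<phi>(x,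
  m) relates \<phi>(x, x) to u(x) u(m). The values of \<open>g\<close> and \<open>h\<close> at zero
  are tracked throughout and cancel only at the end.\<close>

lemma sigma_iff_phi_diagonal:
  assumes x: "x \<in> carrier B"
    and phi_add: "\<And>x y y'. \<lbrakk>x \<in> carrier B; y \<in> carrier B; y' \<in> carrier B\<rbrakk> \<Longrightarrow>
      \<phi> (x, y \<otimes>\<^bsub>B\<^esub> y') = h (x, y, y') \<otimes> g (y, y', x) \<otimes> (\<phi> (x, y) \<otimes> \<phi> (x, y'))"
  shows "u (inv\<^bsub>B\<^esub> x) \<otimes> g (inv\<^bsub>B\<^esub> x, x, inv\<^bsub>B\<^esub> x) \<otimes> g (\<one>\<^bsub>B\<^esub>, \<one>\<^bsub>B\<^esub>, inv\<^bsub>B\<^esub> x)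
      = u x \<otimes> h (x, inv\<^bsub>B\<^esub> x, x) \<otimes> h (x, \<one>\<^bsub>B\<^esub>, \<one>\<^bsub>B\<^esub>)
    \<longleftrightarrow> u x \<otimes> u x = \<phi> (x, x)"
proof -
  define m where "m = inv\<^bsub>B\<^esub> x"
  define n where "n = \<one>\<^bsub>B\<^esub>"
  have [simp]: "x \<in> carrier B" "m \<in> carrier B" "n \<in> carrier B" "x \<otimes>\<^bsub>B\<^esub> m = n" "n \<otimes>\<^bsub>B\<^esub> n = n"
    using x by (simp_all add: m_def n_def)
  have one: "a = \<one>" if "a \<in> carrier A" "b \<in> carrier A" "b = a \<otimes> b" for a b
    using that by (metis A.r_cancel_one')
  \<comment> \<open>Additivity of \<open>\<phi>\<close> applied to 0 + 0 = 0; one factor \<phi>(y,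
    0) cancels.\<close>
  have phi_n: "h (y, n, n) \<otimes> g (n, n, y) \<otimes> \<phi> (y, n) = \<one>" if [simp]: "y \<in> carrier B" for y
    by (rule one [of _ "\<phi> (y, n)"]) (use phi_add [of y n n] in \<open>simp_all add: A.m_ac\<close>)
  \<comment> \<open>At zero, (3) has the form h g g = g h h.\<close>
  have gh_n: "g (n, n, n) = h (n, n, n)"
    using interchange [of n n n n] by (simp add: A.m_ac)
  have "lam2 n n \<otimes> \<phi> (n, n) = h (n, n, n) \<otimes> (h (n, n, n) \<otimes> g (n, n, n) \<otimes> \<phi> (n, n))"
    by (simp add: lam2_def A.m_ac)
  also have "\<dots> = h (n, n, n)" by (simp add: phi_n)
  finally have u_n: "h (n, n, n) \<otimes> u n = \<one>"
    using u_add [of n n] by (intro one [of _ "u n"]) (simp_all add: A.m_assoc)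
  let ?H = "h (x, x, m)" and ?H' = "h (m, x, m)"
  let ?G = "g (x, m, x)" and ?G' = "g (x, m, m)" and ?Gn = "g (x, m, n)"
  let ?k = "h (x, n, n)" and ?a = "g (n, n, x)" and ?b = "g (n, n, m)"
    and ?d = "h (n, x, m)" and ?c = "g (n, n, n)"
  let ?q = "\<phi> (x, m)"
  have dG: "?d \<otimes> (?G \<otimes> ?G') = ?Gn \<otimes> (?H \<otimes> ?H')"
    using interchange [of x m x m] by simp
  \<comment> \<open>In this instance of (3) both summands in the first variable are zero, so h(0; x,
    m) occurs twice on the right and once on the left.\<close>
  have "?d \<otimes> (?a \<otimes> ?b) = ?d \<otimes> (?c \<otimes> ?d)"
    using interchange [of n n x m] by (simp add: A.m_ac)
  then have ab: "?a \<otimes> ?b = ?c \<otimes> ?d" by simp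
  \<comment> \<open>Chosen so that \<open>?K\<close> times the left side of \<open>*\<close>
    contains the whole expansion of \<phi>(x, x + m), together with the correction making \<phi>(x,
    0) trivial.\<close>
  let ?K = "?q \<otimes> ?G \<otimes> ?a"
  have "?K \<otimes> (\<phi> (x, x) \<otimes> ?H \<otimes> ?k) = ?k \<otimes> ?a \<otimes> \<phi> (x, n)"
    using phi_add [of x x m] by (simp add: A.m_ac)
  \<comment> \<open>Both sides are 1, the left by \<open>phi_n\<close> and the right by
    \<open>gh_n\<close> and \<open>u_n\<close>. Passing through 1 introduces u(0), which can then be
    expanded as u(x + m).\<close>
  also have "\<dots> = ?c \<otimes> u n"
    by (simp add: phi_n u_n gh_n)
  also have "u n = ?Gn \<otimes> (?H \<otimes> ?H') \<otimes> (?q \<otimes> u x \<otimes> u m)"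
    using u_add [of x m] by (simp add: lam2_def A.m_ac)
  also have "\<dots> = ?d \<otimes> (?G \<otimes> ?G') \<otimes> (?q \<otimes> u x \<otimes> u m)"
    by (simp only: dG)
  also have "?c \<otimes> \<dots> = (?c \<otimes> ?d) \<otimes> (?G \<otimes> ?G' \<otimes> ?q \<otimes> u x \<otimes> u m)"
    by (simp add: A.m_ac)
  also have "\<dots> = ?K \<otimes> (u x \<otimes> (u m \<otimes> ?G' \<otimes> ?b))"
    unfolding ab [symmetric] by (simp add: A.m_ac)
  finally have *: "\<phi> (x, x) \<otimes> ?H \<otimes> ?k = u x \<otimes> (u m \<otimes> ?G' \<otimes> ?b)" by simp
  have "u m \<otimes> ?G' \<otimes> ?b = u x \<otimes> ?H \<otimes> ?k
      \<longleftrightarrow> u x \<otimes> (u m \<otimes> ?G' \<otimes> ?b) = u x \<otimes> (u x \<otimes> ?H \<otimes> ?k)" by simp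
  also have "\<dots> \<longleftrightarrow> (?H \<otimes> ?k) \<otimes> \<phi> (x, x) = (?H \<otimes> ?k) \<otimes> (u x \<otimes> u x)"
    unfolding * [symmetric] by (simp add: A.m_ac)
  also have "\<dots> \<longleftrightarrow> u x \<otimes> u x = \<phi> (x, x)" by auto
  finally show ?thesis
    unfolding m_def [symmetric] n_def [symmetric] by (simp add: g_commute [of m x] h_commute [of x m])
qed

end

section \<open>Sheaves and the trivial torsor\<close>

lemma sec_und [simp]: "sec (und G) U = carrier (grp G U)"
  and res_und [simp]: "res (und G) = gres G"
  and sec_prod_sh [simp]: "sec (F \<times>\<^sub>s F') U = sec F U \<times> sec F' U"
  and res_prod_sh [simp]: "res (F \<times>\<^sub>s F') f p = (res F f (fst p), res F' f (snd p))"
  by (simp_all add: und_def prod_sh_def split: prod.split)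

text \<open>Both sections glue the compatible family of restrictions of \<open>a\<close>, so the
  uniqueness half of the sheaf condition applies.\<close>

lemma sheaf_separated:
  assumes "sheaf T F" "U \<in> Ob T" "S \<in> Cov T U" "sieve T U S" "a \<in> sec F U" "b \<in> sec F U"
    and eq: "\<And>f. f \<in> S \<Longrightarrow> res F f a = res F f b"
  shows "a = b"
proof -
  have F: "presheaf T F" using assms by (simp add: sheaf_def)
  have S: "f \<in> Ar T" "tgt T f = U" if "f \<in> S" for f
    using that assms(4) by (auto simp: sieve_def)
  have "(\<forall>f\<in>S. res F f a \<in> sec F (src T f)) \<and>
      (\<forall>f\<in>S. \<forall>g\<in>Ar T. tgt T g = src T f \<longrightarrow> res F g (res F f a) = res F (cmp T f g) a)"
    using F assms(5) S by (auto simp: presheaf_def Pi_iff)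
  then have "\<exists>!s. s \<in> sec F U \<and> (\<forall>f\<in>S. res F f s = res F f a)"
    using assms(1-3) unfolding sheaf_def by (auto dest!: bspec spec)
  then show ?thesis using assms(5,6) eq by metis
qed

lemma sheaf_prod_sh:
  assumes F: "sheaf T F" and G: "sheaf T G"
  shows "sheaf T (F \<times>\<^sub>s G)"
  unfolding sheaf_def
proof (intro conjI ballI allI impI)
  show "presheaf T (F \<times>\<^sub>s G)"
    using F G by (auto simp: sheaf_def presheaf_def Pi_iff)
  fix U S x
  assume U: "U \<in> Ob T" and S: "S \<in> Cov T U"
    and x: "(\<forall>f\<in>S. x f \<in> sec (F \<times>\<^sub>s G) (src T f)) \<and>
      (\<forall>f\<in>S. \<forall>g\<in>Ar T. tgt T g = src T f \<longrightarrow> res (F \<times>\<^sub>s G) g (x f) = x (cmp T f g))"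
  have "\<exists>!s. s \<in> sec F U \<and> (\<forall>f\<in>S. res F f s = (fst \<circ> x) f)"
    using F U S x unfolding sheaf_def by (elim conjE) (drule bspec [OF _ U], drule bspec [OF _ S],
      drule spec [of _ "fst \<circ> x"], force simp: mem_Times_iff prod_eq_iff)
  moreover have "\<exists>!s. s \<in> sec G U \<and> (\<forall>f\<in>S. res G f s = (snd \<circ> x) f)"
    using G U S x unfolding sheaf_def by (elim conjE) (drule bspec [OF _ U], drule bspec [OF _ S],
      drule spec [of _ "snd \<circ> x"], force simp: mem_Times_iff prod_eq_iff)
  ultimately show "\<exists>!s. s \<in> sec (F \<times>\<^sub>s G) U \<and> (\<forall>f\<in>S. res (F \<times>\<^sub>s G) f s = x f)"
    by (simp add: prod_eq_iff mem_Times_iff Ex1_def) metis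
qed

lemma Mor_closed: "\<lbrakk>\<eta> \<in> Mor T F G; U \<in> Ob T; x \<in> sec F U\<rbrakk> \<Longrightarrow> \<eta> U x \<in> sec G U"
  by (auto simp: Mor_def PiE_iff)

lemma Mor_natural:
  "\<lbrakk>\<eta> \<in> Mor T F G; f \<in> Ar T; x \<in> sec F (tgt T f)\<rbrakk>
    \<Longrightarrow> \<eta> (src T f) (res F f x) = res G f (\<eta> (tgt T f) x)"
  by (auto simp: Mor_def)

text \<open>Morphisms are extensional in the object and in the section, so agreement on sections is
  equality in HOL. All uniqueness claims about laws, sections and maps rest on this.\<close>

lemma Mor_eqI:
  assumes "\<eta> \<in> Mor T F G" "\<theta> \<in> Mor T F G"
    and "\<And>U x. \<lbrakk>U \<in> Ob T; x \<in> sec F U\<rbrakk> \<Longrightarrow> \<eta> U x = \<theta> U x"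
  shows "\<eta> = \<theta>"
proof
  fix U
  show "\<eta> U = \<theta> U"
  proof (cases "U \<in> Ob T")
    case True
    with assms have "\<eta> U \<in> sec F U \<rightarrow>\<^sub>E sec G U" "\<theta> U \<in> sec F U \<rightarrow>\<^sub>E sec G U"
      by (auto simp: Mor_def PiE_iff)
    then show ?thesis using assms(3) True by (intro PiE_ext)
  next
    case False
    with assms show ?thesis by (auto simp: Mor_def PiE_iff extensional_def)
  qed
qed

text \<open>Cuts a formula down to the carriers, the normal form that membership in
  \<open>Mor\<close> demands.\<close>

definition mor :: "('o, 'm) site_data \<Rightarrow> ('o, 'm, 'x) presheaf_data \<Rightarrow> ('o \<Rightarrow> 'x \<Rightarrow> 'y) \<Rightarrow> 'o \<Rightarrow> 'x \<Rightarrow> 'y" where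
  "mor T F \<eta> = (\<lambda>U\<in>Ob T. \<lambda>x\<in>sec F U. \<eta> U x)"

lemma mor_apply [simp]: "\<lbrakk>U \<in> Ob T; x \<in> sec F U\<rbrakk> \<Longrightarrow> mor T F \<eta> U x = \<eta> U x"
  by (simp add: mor_def)

lemma (in small_category) mor_in_Mor:
  assumes "\<And>f x. \<lbrakk>f \<in> Ar T; x \<in> sec F (tgt T f)\<rbrakk> \<Longrightarrow> res F f x \<in> sec F (src T f)"
    and "\<And>U x. \<lbrakk>U \<in> Ob T; x \<in> sec F U\<rbrakk> \<Longrightarrow> \<eta> U x \<in> sec G U"
    and "\<And>f x. \<lbrakk>f \<in> Ar T; x \<in> sec F (tgt T f)\<rbrakk> \<Longrightarrow> \<eta> (src T f) (res F f x) = res G f (\<eta> (tgt T f) x)"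
  shows "mor T F \<eta> \<in> Mor T F G"
  using assms src_Ob tgt_Ob by (auto simp: Mor_def mor_def)

section \<open>Restriction maps of A and B\<close>

context topos_groups
begin

sublocale site T by (rule site)

lemma A_comm_group: "U \<in> Ob T \<Longrightarrow> comm_group (grp A U)"
  and B_comm_group: "U \<in> Ob T \<Longrightarrow> comm_group (grp B U)"
  using abelian_A abelian_B by (auto simp: abelian_group_sheaf_def)

lemma A_group: "U \<in> Ob T \<Longrightarrow> group (grp A U)"
  and B_group: "U \<in> Ob T \<Longrightarrow> group (grp B U)"
  using A_comm_group B_comm_group by (blast intro: comm_group.axioms(2))+

lemma sheaf_A: "sheaf T (und A)" and sheaf_B: "sheaf T (und B)"
  using abelian_A abelian_B by (auto simp: abelian_group_sheaf_def)

lemma A_res_hom: "f \<in> Ar T \<Longrightarrow> group_hom (grp A (tgt T f)) (grp A (src T f)) (gres A f)"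
  and B_res_hom: "f \<in> Ar T \<Longrightarrow> group_hom (grp B (tgt T f)) (grp B (src T f)) (gres B f)"
  using abelian_A abelian_B A_group B_group src_Ob tgt_Ob
  by (auto simp: abelian_group_sheaf_def group_hom_def group_hom_axioms_def)

lemma A_res_closed [simp]: "\<lbrakk>f \<in> Ar T; a \<in> A_sec (tgt T f)\<rbrakk> \<Longrightarrow> gres A f a \<in> A_sec (src T f)"
  and B_res_closed [simp]: "\<lbrakk>f \<in> Ar T; x \<in> B_sec (tgt T f)\<rbrakk> \<Longrightarrow> gres B f x \<in> B_sec (src T f)"
  using A_res_hom B_res_hom by (auto dest: group_hom.hom_closed)

lemma A_res_mult [simp]: "\<lbrakk>f \<in> Ar T; a \<in> A_sec (tgt T f); b \<in> A_sec (tgt T f)\<rbrakk>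
    \<Longrightarrow> gres A f (a \<cdot>\<^bsub>tgt T f\<^esub> b) = gres A f a \<cdot>\<^bsub>src T f\<^esub> gres A f b"
  and B_res_add [simp]: "\<lbrakk>f \<in> Ar T; x \<in> B_sec (tgt T f); y \<in> B_sec (tgt T f)\<rbrakk>
    \<Longrightarrow> gres B f (x \<^bold>+\<^bsub>tgt T f\<^esub> y) = gres B f x \<^bold>+\<^bsub>src T f\<^esub> gres B f y"
  using A_res_hom B_res_hom by (auto simp: group_hom.hom_mult)

lemma A_res_one [simp]: "f \<in> Ar T \<Longrightarrow> gres A f (A_one (tgt T f)) = A_one (src T f)"
  and B_res_zero [simp]: "f \<in> Ar T \<Longrightarrow> gres B f (B_zero (tgt T f)) = B_zero (src T f)"
  using A_res_hom B_res_hom by (auto simp: group_hom.hom_one)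

lemma A_res_inv [simp]: "\<lbrakk>f \<in> Ar T; a \<in> A_sec (tgt T f)\<rbrakk>
    \<Longrightarrow> gres A f (inv\<^bsub>grp A (tgt T f)\<^esub> a) = inv\<^bsub>grp A (src T f)\<^esub> (gres A f a)"
  and B_res_neg [simp]: "\<lbrakk>f \<in> Ar T; x \<in> B_sec (tgt T f)\<rbrakk>
    \<Longrightarrow> gres B f (B_neg (tgt T f) x) = B_neg (src T f) (gres B f x)"
  using A_res_hom B_res_hom by (auto simp: group_hom.hom_inv)

lemmas A_closed [simp] =
  monoid.m_closed [OF group.is_monoid [OF A_group]] monoid.one_closed [OF group.is_monoid [OF A_group]]
  group.inv_closed [OF A_group] monoid.l_one [OF group.is_monoid [OF A_group]]

lemmas B_closed [simp] =
  monoid.m_closed [OF group.is_monoid [OF B_group]] monoid.one_closed [OF group.is_monoid [OF B_group]]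
  group.inv_closed [OF B_group]

section \<open>The trivial torsor, its fibres and contracted products\<close>

abbreviation \<E> :: "('o, 'm, 'a, 'b \<times> 'b, 'a \<times> 'b \<times> 'b) torsor_data" where
  "\<E> \<equiv> trivial_torsor"

lemma sec_trivial [simp]: "sec (Tot \<E>) U = A_sec U \<times> B_sec U \<times> B_sec U"
  and res_trivial [simp]: "res (Tot \<E>) f e = (gres A f (fst e), gres B f (fst (snd e)), gres B f (snd (snd e)))"
  and prj_trivial [simp]: "\<lbrakk>U \<in> Ob T; e \<in> A_sec U \<times> B_sec U \<times> B_sec U\<rbrakk> \<Longrightarrow> prj \<E> U e = snd e"
  and act_trivial [simp]: "\<lbrakk>U \<in> Ob T; a \<in> A_sec U; e \<in> A_sec U \<times> B_sec U \<times> B_sec U\<rbrakk>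
    \<Longrightarrow> act \<E> U (a, e) = (a \<cdot>\<^bsub>U\<^esub> fst e, snd e)"
  by (auto simp: trivial_torsor_def)

lemma torsor_trivial: "torsor (und B \<times>\<^sub>s und B) \<E>"
  unfolding torsor_def
proof (intro conjI ballI impI)
  show "sheaf T (Tot \<E>)"
    by (simp add: trivial_torsor_def sheaf_prod_sh sheaf_A sheaf_B)
  have "prj \<E> = mor T (Tot \<E>) (\<lambda>U e. snd e)"
    by (auto simp: mor_def trivial_torsor_def restrict_def fun_eq_iff)
  moreover have "mor T (Tot \<E>) (\<lambda>U e. snd e) \<in> Mor T (Tot \<E>) (und B \<times>\<^sub>s und B)"
    by (rule mor_in_Mor) auto
  ultimately show "prj \<E> \<in> Mor T (Tot \<E>) (und B \<times>\<^sub>s und B)" by simp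
  have "act \<E> = mor T (und A \<times>\<^sub>s Tot \<E>) (\<lambda>U (a, e). (a \<cdot>\<^bsub>U\<^esub> fst e, snd e))"
    by (auto simp: mor_def trivial_torsor_def restrict_def fun_eq_iff)
  moreover have "mor T (und A \<times>\<^sub>s Tot \<E>) (\<lambda>U (a, e). (a \<cdot>\<^bsub>U\<^esub> fst e, snd e))
      \<in> Mor T (und A \<times>\<^sub>s Tot \<E>) (Tot \<E>)"
    by (rule mor_in_Mor) auto
  ultimately show "act \<E> \<in> Mor T (und A \<times>\<^sub>s Tot \<E>) (Tot \<E>)" by simp
next
  fix U e assume U: "U \<in> Ob T" and e: "e \<in> sec (Tot \<E>) U"
  interpret A: comm_group "grp A U" by (rule A_comm_group [OF U])
  show "act \<E> U (A_one U, e) = e" using U e by auto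
  show "prj \<E> U (act \<E> U (a, e)) = prj \<E> U e" if "a \<in> A_sec U" for a
    using U e that by (auto simp: mem_Times_iff)
  show "act \<E> U (a \<cdot>\<^bsub>U\<^esub> a', e) = act \<E> U (a, act \<E> U (a', e))" if "a \<in> A_sec U" "a' \<in> A_sec U" for a a'
    using U e that by (auto simp: mem_Times_iff A.m_assoc)
  show "\<exists>!a. a \<in> A_sec U \<and> act \<E> U (a, e) = e'"
    if e': "e' \<in> sec (Tot \<E>) U" "prj \<E> U e = prj \<E> U e'" for e'
  proof (rule ex1I [of _ "fst e' \<^bold>/\<^bsub>U\<^esub> fst e"])
    have e_simps: "fst e \<in> A_sec U" "fst e' \<in> A_sec U" "snd e' = snd e"
      using U e e' by (simp_all add: mem_Times_iff)
    then show "fst e' \<^bold>/\<^bsub>U\<^esub> fst e \<in> A_sec U \<and> act \<E> U (fst e' \<^bold>/\<^bsub>U\<^esub> fst e, e) = e'"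
      using U e by (simp add: A.m_assoc prod_eq_iff)
    fix a assume a: "a \<in> A_sec U \<and> act \<E> U (a, e) = e'"
    then have "fst e' = a \<cdot>\<^bsub>U\<^esub> fst e" using U e by auto
    then show "a = fst e' \<^bold>/\<^bsub>U\<^esub> fst e"
      using a e_simps by (simp add: A.m_assoc)
  qed
next
  fix U x assume U: "U \<in> Ob T" and x: "x \<in> sec (und B \<times>\<^sub>s und B) U"
  show "\<exists>S\<in>Cov T U. \<forall>f\<in>S. \<exists>e\<in>sec (Tot \<E>) (src T f).
      prj \<E> (src T f) e = res (und B \<times>\<^sub>s und B) f x"
  \<comment> \<open>Base points exist over every object, so the maximal sieve already serves as the
    covering.\<close>
  proof (intro bexI ballI)
    show "{f \<in> Ar T. tgt T f = U} \<in> Cov T U" by (rule Cov_maximal [OF U])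
    fix f assume f: "f \<in> {f \<in> Ar T. tgt T f = U}"
    let ?e = "(A_one (src T f), res (und B \<times>\<^sub>s und B) f x)"
    show "?e \<in> sec (Tot \<E>) (src T f)" "prj \<E> (src T f) ?e = res (und B \<times>\<^sub>s und B) f x"
      using f x src_Ob by auto
  qed
qed

lemma fib_trivial: "U \<in> Ob T \<Longrightarrow> x \<in> B_sec U \<Longrightarrow> y \<in> B_sec U \<Longrightarrow>
    fib \<E> U x y = (\<lambda>a. (a, x, y)) ` A_sec U"
  by (auto simp: fib_def)

lemma sec_dom_law1 [simp]: "U \<in> Ob T \<Longrightarrow> sec (dom_law1 \<E>) U =
    {(e, e'). e \<in> A_sec U \<times> B_sec U \<times> B_sec U \<and> e' \<in> A_sec U \<times> B_sec U \<times> B_sec U \<and>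
      snd (snd e) = snd (snd e')}"
  and sec_dom_law2 [simp]: "U \<in> Ob T \<Longrightarrow> sec (dom_law2 \<E>) U =
    {(e, e'). e \<in> A_sec U \<times> B_sec U \<times> B_sec U \<and> e' \<in> A_sec U \<times> B_sec U \<times> B_sec U \<and>
      fst (snd e) = fst (snd e')}"
  and res_dom_law1 [simp]: "res (dom_law1 \<E>) = res (Tot \<E> \<times>\<^sub>s Tot \<E>)"
  and res_dom_law2 [simp]: "res (dom_law2 \<E>) = res (Tot \<E> \<times>\<^sub>s Tot \<E>)"
  by (auto simp: dom_law1_def dom_law2_def)

text \<open>Multiplying the entries by \<open>as\<close> multiplies the product of the
  \<open>A\<close>-components by the product of \<open>as\<close>. Multipliers of total product 1
  thus leave this product as the only invariant beyond the position of each entry over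
  \<open>B\<close>.\<close>

lemma mem_wedge_trivial:
  assumes U: "U \<in> Ob T" and "set es \<subseteq> A_sec U \<times> B_sec U \<times> B_sec U"
  shows "es' \<in> wedge \<E> U es \<longleftrightarrow> set es' \<subseteq> A_sec U \<times> B_sec U \<times> B_sec U \<and> map snd es' = map snd es \<and>
    foldr (\<lambda>a b. a \<cdot>\<^bsub>U\<^esub> b) (map fst es') (A_one U) = foldr (\<lambda>a b. a \<cdot>\<^bsub>U\<^esub> b) (map fst es) (A_one U)"
proof -
  interpret A: comm_group "grp A U" by (rule A_comm_group [OF U])
  let ?P = "\<lambda>as. foldr (\<lambda>a b. a \<cdot>\<^bsub>U\<^esub> b) as (A_one U)"
  have P_closed: "set as \<subseteq> A_sec U \<Longrightarrow> ?P as \<in> A_sec U" for as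
    by (induction as) (use U in auto)
  have fwd: "length as = length es \<Longrightarrow> set as \<subseteq> A_sec U \<Longrightarrow> set es \<subseteq> A_sec U \<times> B_sec U \<times> B_sec U \<Longrightarrow>
      set (map2 (\<lambda>a e. act \<E> U (a, e)) as es) \<subseteq> A_sec U \<times> B_sec U \<times> B_sec U \<and>
      map snd (map2 (\<lambda>a e. act \<E> U (a, e)) as es) = map snd es \<and>
      ?P (map fst (map2 (\<lambda>a e. act \<E> U (a, e)) as es)) = ?P as \<cdot>\<^bsub>U\<^esub> ?P (map fst es)" for as es
  proof (induction as es rule: list_induct2)
    case (Cons a as e es)
    moreover have "?P (map fst es) \<in> A_sec U" "?P as \<in> A_sec U"
      using Cons.prems by (intro P_closed; force)+
    ultimately show ?case using U by (auto simp: A.m_ac)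
  qed (use U in simp)
  \<comment> \<open>The multipliers are the quotients of the \<open>A\<close>-components, position
    by position.\<close>
  have bwd: "length es' = length es \<Longrightarrow> map snd es' = map snd es \<Longrightarrow>
      set es' \<subseteq> A_sec U \<times> B_sec U \<times> B_sec U \<Longrightarrow> set es \<subseteq> A_sec U \<times> B_sec U \<times> B_sec U \<Longrightarrow>
      \<exists>as. length as = length es \<and> set as \<subseteq> A_sec U \<and> es' = map2 (\<lambda>a e. act \<E> U (a, e)) as es" for es' es
  proof (induction es' es rule: list_induct2)
    case (Cons e' es' e es)
    then obtain as where as: "length as = length es" "set as \<subseteq> A_sec U"
      "es' = map2 (\<lambda>a e. act \<E> U (a, e)) as es" by auto
    show ?case
      using Cons.prems as U
      by (intro exI [of _ "(fst e' \<^bold>/\<^bsub>U\<^esub> fst e) # as"]) (auto simp: A.m_assoc)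
  qed simp
  have es: "?P (map fst es) \<in> A_sec U" using assms(2) by (intro P_closed) force
  have ones: "?P as = A_one U" if "set as \<subseteq> A_sec U" "?P as \<cdot>\<^bsub>U\<^esub> ?P (map fst es) = ?P (map fst es)" for as
    using A.r_cancel_one [OF es P_closed [OF that(1)]] that(2) by blast
  show ?thesis
  proof
    assume "es' \<in> wedge \<E> U es"
    then obtain as where as: "length as = length es" "set as \<subseteq> A_sec U" "?P as = A_one U"
      "es' = map2 (\<lambda>a e. act \<E> U (a, e)) as es"
      unfolding wedge_def by blast
    then show "set es' \<subseteq> A_sec U \<times> B_sec U \<times> B_sec U \<and> map snd es' = map snd es \<and>
        ?P (map fst es') = ?P (map fst es)"
      using fwd [OF as(1,2) assms(2)] es by simp
  next
    assume *: "set es' \<subseteq> A_sec U \<times> B_sec U \<times> B_sec U \<and> map snd es' = map snd es \<and>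
        ?P (map fst es') = ?P (map fst es)"
    then obtain as where as: "length as = length es" "set as \<subseteq> A_sec U"
      "es' = map2 (\<lambda>a e. act \<E> U (a, e)) as es"
      using bwd [of es' es] assms(2) by (metis length_map)
    then have "?P as = A_one U" using fwd [OF as(1,2) assms(2)] * by (intro ones) simp_all
    then show "es' \<in> wedge \<E> U es" using as unfolding wedge_def by blast
  qed
qed

lemma wedge_trivial_eq_iff:
  assumes U: "U \<in> Ob T" and es: "set es \<subseteq> A_sec U \<times> B_sec U \<times> B_sec U"
    and es': "set es' \<subseteq> A_sec U \<times> B_sec U \<times> B_sec U"
  shows "wedge \<E> U es = wedge \<E> U es' \<longleftrightarrow> map snd es = map snd es' \<and>
    foldr (\<lambda>a b. a \<cdot>\<^bsub>U\<^esub> b) (map fst es) (A_one U) = foldr (\<lambda>a b. a \<cdot>\<^bsub>U\<^esub> b) (map fst es') (A_one U)"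
proof -
  have "es \<in> wedge \<E> U es" using U es by (simp add: mem_wedge_trivial)
  then show ?thesis
    using U es es' by (auto simp: mem_wedge_trivial set_eq_iff)
qed

lemma Mor1_closed: "\<lbrakk>u \<in> Mor T (und B) (und A); U \<in> Ob T; x \<in> B_sec U\<rbrakk> \<Longrightarrow> u U x \<in> A_sec U"
  and Mor2_closed: "\<lbrakk>k \<in> Mor T (und B \<times>\<^sub>s und B) (und A); U \<in> Ob T; x \<in> B_sec U; y \<in> B_sec U\<rbrakk>
    \<Longrightarrow> k U (x, y) \<in> A_sec U"
  and Mor3_closed: "\<lbrakk>g \<in> Mor T (und B \<times>\<^sub>s und B \<times>\<^sub>s und B) (und A); U \<in> Ob T;
      x \<in> B_sec U; y \<in> B_sec U; z \<in> B_sec U\<rbrakk> \<Longrightarrow> g U (x, y, z) \<in> A_sec U"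
  using Mor_closed [of u T "und B" "und A" U x] Mor_closed [of k T "und B \<times>\<^sub>s und B" "und A" U "(x, y)"]
    Mor_closed [of g T "und B \<times>\<^sub>s und B \<times>\<^sub>s und B" "und A" U "(x, y, z)"] by simp_all

lemma Mor1_natural: "\<lbrakk>u \<in> Mor T (und B) (und A); f \<in> Ar T; x \<in> B_sec (tgt T f)\<rbrakk>
    \<Longrightarrow> gres A f (u (tgt T f) x) = u (src T f) (gres B f x)"
  and Mor2_natural: "\<lbrakk>k \<in> Mor T (und B \<times>\<^sub>s und B) (und A); f \<in> Ar T;
      x \<in> B_sec (tgt T f); y \<in> B_sec (tgt T f)\<rbrakk>
    \<Longrightarrow> gres A f (k (tgt T f) (x, y)) = k (src T f) (gres B f x, gres B f y)"
  and Mor3_natural: "\<lbrakk>g \<in> Mor T (und B \<times>\<^sub>s und B \<times>\<^sub>s und B) (und A); f \<in> Ar T;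
      x \<in> B_sec (tgt T f); y \<in> B_sec (tgt T f); z \<in> B_sec (tgt T f)\<rbrakk>
    \<Longrightarrow> gres A f (g (tgt T f) (x, y, z)) = g (src T f) (gres B f x, gres B f y, gres B f z)"
  using Mor_natural [of u T "und B" "und A" f x] Mor_natural [of k T "und B \<times>\<^sub>s und B" "und A" f "(x, y)"]
    Mor_natural [of g T "und B \<times>\<^sub>s und B \<times>\<^sub>s und B" "und A" f "(x, y, z)"] by simp_all

section \<open>Partial laws on the trivial torsor and their cocycles\<close>

definition law1 where
  "law1 P1 g \<longleftrightarrow> (\<forall>U\<in>Ob T. \<forall>a1\<in>A_sec U. \<forall>a2\<in>A_sec U. \<forall>b1\<in>B_sec U. \<forall>b2\<in>B_sec U. \<forall>b'\<in>B_sec U.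
     P1 U ((a1, b1, b'), (a2, b2, b')) = (a1 \<cdot>\<^bsub>U\<^esub> a2 \<cdot>\<^bsub>U\<^esub> g U (b1, b2, b'), b1 \<^bold>+\<^bsub>U\<^esub> b2, b'))"

definition law2 where
  "law2 P2 h \<longleftrightarrow> (\<forall>U\<in>Ob T. \<forall>a1\<in>A_sec U. \<forall>a2\<in>A_sec U. \<forall>b\<in>B_sec U. \<forall>b1'\<in>B_sec U. \<forall>b2'\<in>B_sec U.
     P2 U ((a1, b, b1'), (a2, b, b2')) = (a1 \<cdot>\<^bsub>U\<^esub> a2 \<cdot>\<^bsub>U\<^esub> h U (b, b1', b2'), b, b1' \<^bold>+\<^bsub>U\<^esub> b2'))"

text \<open>Conditions (1) to (3) over a single object, with the fractions of (3) cleared.\<close>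

definition biext_cocycles where
  "biext_cocycles g h U \<longleftrightarrow>
     (\<forall>b1\<in>B_sec U. \<forall>b2\<in>B_sec U. \<forall>b3\<in>B_sec U. \<forall>b'\<in>B_sec U.
        g U (b2, b3, b') \<cdot>\<^bsub>U\<^esub> g U (b1, b2 \<^bold>+\<^bsub>U\<^esub> b3, b') = g U (b1 \<^bold>+\<^bsub>U\<^esub> b2, b3, b') \<cdot>\<^bsub>U\<^esub> g U (b1, b2, b')) \<and>
     (\<forall>b\<in>B_sec U. \<forall>b1'\<in>B_sec U. \<forall>b2'\<in>B_sec U. \<forall>b3'\<in>B_sec U.
        h U (b, b2', b3') \<cdot>\<^bsub>U\<^esub> h U (b, b1', b2' \<^bold>+\<^bsub>U\<^esub> b3') = h U (b, b1' \<^bold>+\<^bsub>U\<^esub> b2', b3') \<cdot>\<^bsub>U\<^esub> h U (b, b1', b2')) \<and>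
     (\<forall>b1\<in>B_sec U. \<forall>b2\<in>B_sec U. \<forall>b'\<in>B_sec U. g U (b1, b2, b') = g U (b2, b1, b')) \<and>
     (\<forall>b\<in>B_sec U. \<forall>b1'\<in>B_sec U. \<forall>b2'\<in>B_sec U. h U (b, b1', b2') = h U (b, b2', b1')) \<and>
     (\<forall>b1\<in>B_sec U. \<forall>b2\<in>B_sec U. \<forall>b1'\<in>B_sec U. \<forall>b2'\<in>B_sec U.
        h U (b1 \<^bold>+\<^bsub>U\<^esub> b2, b1', b2') \<cdot>\<^bsub>U\<^esub> (g U (b1, b2, b1') \<cdot>\<^bsub>U\<^esub> g U (b1, b2, b2')) =
        g U (b1, b2, b1' \<^bold>+\<^bsub>U\<^esub> b2') \<cdot>\<^bsub>U\<^esub> (h U (b1, b1', b2') \<cdot>\<^bsub>U\<^esub> h U (b2, b1', b2')))"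

end

text \<open>Laws and cocycles are both given and only linked by formulas; neither the biextension
  axioms nor the cocycle identities are assumed. The context can therefore be entered from either
  side of the correspondence.\<close>

locale trivial_laws = topos_groups T A B
  for T :: "('o, 'm) site_data" and A :: "('o, 'm, 'a) group_sheaf" and B :: "('o, 'm, 'b) group_sheaf" +
  fixes P1 P2 :: "'o \<Rightarrow> ('a \<times> 'b \<times> 'b) \<times> ('a \<times> 'b \<times> 'b) \<Rightarrow> 'a \<times> 'b \<times> 'b"
    and g h :: "'o \<Rightarrow> 'b \<times> 'b \<times> 'b \<Rightarrow> 'a"
  assumes P1_Mor: "P1 \<in> Mor T (dom_law1 \<E>) (Tot \<E>)"
    and P2_Mor: "P2 \<in> Mor T (dom_law2 \<E>) (Tot \<E>)"
    and g_Mor: "g \<in> Mor T (und B \<times>\<^sub>s und B \<times>\<^sub>s und B) (und A)"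
    and h_Mor: "h \<in> Mor T (und B \<times>\<^sub>s und B \<times>\<^sub>s und B) (und A)"
    and law1: "law1 P1 g"
    and law2: "law2 P2 h"
begin

lemmas g_closed [simp] = Mor3_closed [OF g_Mor]
lemmas h_closed [simp] = Mor3_closed [OF h_Mor]

lemma P1_apply [simp]: "\<lbrakk>U \<in> Ob T; a \<in> A_sec U; a' \<in> A_sec U; x \<in> B_sec U; x' \<in> B_sec U; y \<in> B_sec U\<rbrakk> \<Longrightarrow>
    P1 U ((a, x, y), (a', x', y)) = (a \<cdot>\<^bsub>U\<^esub> a' \<cdot>\<^bsub>U\<^esub> g U (x, x', y), x \<^bold>+\<^bsub>U\<^esub> x', y)"
  and P2_apply [simp]: "\<lbrakk>U \<in> Ob T; a \<in> A_sec U; a' \<in> A_sec U; x \<in> B_sec U; y \<in> B_sec U; y' \<in> B_sec U\<rbrakk> \<Longrightarrow>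
    P2 U ((a, x, y), (a', x, y')) = (a \<cdot>\<^bsub>U\<^esub> a' \<cdot>\<^bsub>U\<^esub> h U (x, y, y'), x, y \<^bold>+\<^bsub>U\<^esub> y')"
  using law1 law2 by (simp_all add: law1_def law2_def)

lemma law_pair_at: "U \<in> Ob T \<Longrightarrow> law_pair (grp A U) (grp B U) (g U) (h U)"
  by (simp add: law_pair_def law_pair_axioms_def A_comm_group B_comm_group)

lemma biextension_iff: "biextension \<E> P1 P2 \<longleftrightarrow> (\<forall>U\<in>Ob T. biext_cocycles g h U)"
proof -
  \<comment> \<open>Fibres and equivariance are automatic from the shape of the formulas, so only
    associativity, commutativity and interchange impose conditions on \<open>g\<close> and
    \<open>h\<close>.\<close>
  have t1: "(\<forall>x\<in>B_sec U. \<forall>x'\<in>B_sec U. \<forall>y\<in>B_sec U. \<forall>e\<in>fib \<E> U x y. \<forall>e'\<in>fib \<E> U x' y.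
        P1 U (e, e') \<in> fib \<E> U (x \<^bold>+\<^bsub>U\<^esub> x') y \<and>
        (\<forall>a\<in>A_sec U. \<forall>a'\<in>A_sec U.
           P1 U (act \<E> U (a, e), act \<E> U (a', e')) = act \<E> U (a \<cdot>\<^bsub>U\<^esub> a', P1 U (e, e'))))"
    if U: "U \<in> Ob T" for U
  proof -
    interpret A: comm_group "grp A U" by (rule A_comm_group [OF U])
    show ?thesis using U by (auto simp: fib_trivial A.m_ac)
  qed
  have t2: "(\<forall>x\<in>B_sec U. \<forall>y\<in>B_sec U. \<forall>y'\<in>B_sec U. \<forall>e\<in>fib \<E> U x y. \<forall>e'\<in>fib \<E> U x y'.
        P2 U (e, e') \<in> fib \<E> U x (y \<^bold>+\<^bsub>U\<^esub> y') \<and>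
        (\<forall>a\<in>A_sec U. \<forall>a'\<in>A_sec U.
           P2 U (act \<E> U (a, e), act \<E> U (a', e')) = act \<E> U (a \<cdot>\<^bsub>U\<^esub> a', P2 U (e, e'))))"
    if U: "U \<in> Ob T" for U
  proof -
    interpret A: comm_group "grp A U" by (rule A_comm_group [OF U])
    show ?thesis using U by (auto simp: fib_trivial A.m_ac)
  qed
  have "((\<forall>x\<in>B_sec U. \<forall>x'\<in>B_sec U. \<forall>x''\<in>B_sec U. \<forall>y\<in>B_sec U.
        \<forall>e\<in>fib \<E> U x y. \<forall>e'\<in>fib \<E> U x' y. \<forall>e''\<in>fib \<E> U x'' y.
        P1 U (P1 U (e, e'), e'') = P1 U (e, P1 U (e', e'')) \<and> P1 U (e, e') = P1 U (e', e)) \<and>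
     (\<forall>x\<in>B_sec U. \<forall>y\<in>B_sec U. \<forall>y'\<in>B_sec U. \<forall>y''\<in>B_sec U.
        \<forall>e\<in>fib \<E> U x y. \<forall>e'\<in>fib \<E> U x y'. \<forall>e''\<in>fib \<E> U x y''.
        P2 U (P2 U (e, e'), e'') = P2 U (e, P2 U (e', e'')) \<and> P2 U (e, e') = P2 U (e', e)) \<and>
     (\<forall>x\<in>B_sec U. \<forall>x'\<in>B_sec U. \<forall>y\<in>B_sec U. \<forall>y'\<in>B_sec U.
        \<forall>a\<in>fib \<E> U x y. \<forall>b\<in>fib \<E> U x' y. \<forall>c\<in>fib \<E> U x y'. \<forall>d\<in>fib \<E> U x' y'.
        P2 U (P1 U (a, b), P1 U (c, d)) = P1 U (P2 U (a, c), P2 U (b, d))))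
    \<longleftrightarrow> biext_cocycles g h U" if U: "U \<in> Ob T" for U
  proof -
    interpret A: comm_group "grp A U" by (rule A_comm_group [OF U])
    interpret B: comm_group "grp B U" by (rule B_comm_group [OF U])
    note U [simp]
    have [simp]: "A_sec U \<noteq> {}" "B_sec U \<noteq> {}"
      using A.one_closed B.one_closed by blast+
    have assoc1: "a \<cdot>\<^bsub>U\<^esub> a' \<cdot>\<^bsub>U\<^esub> g U (x, x', y) \<cdot>\<^bsub>U\<^esub> a'' \<cdot>\<^bsub>U\<^esub> g U (x \<^bold>+\<^bsub>U\<^esub> x', x'', y)
        = a \<cdot>\<^bsub>U\<^esub> (a' \<cdot>\<^bsub>U\<^esub> a'' \<cdot>\<^bsub>U\<^esub> g U (x', x'', y)) \<cdot>\<^bsub>U\<^esub> g U (x, x' \<^bold>+\<^bsub>U\<^esub> x'', y)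
      \<longleftrightarrow> g U (x', x'', y) \<cdot>\<^bsub>U\<^esub> g U (x, x' \<^bold>+\<^bsub>U\<^esub> x'', y) = g U (x \<^bold>+\<^bsub>U\<^esub> x', x'', y) \<cdot>\<^bsub>U\<^esub> g U (x, x', y)"
      if "x \<in> B_sec U" "x' \<in> B_sec U" "x'' \<in> B_sec U" "y \<in> B_sec U" "a \<in> A_sec U" "a' \<in> A_sec U" "a'' \<in> A_sec U"
      for x x' x'' y a a' a''
      by (subst eq_commute, rule A.cancel_iff [of "a \<cdot>\<^bsub>U\<^esub> a' \<cdot>\<^bsub>U\<^esub> a''"]) (use that in \<open>simp_all add: A.m_ac\<close>)
    have assoc2: "a \<cdot>\<^bsub>U\<^esub> a' \<cdot>\<^bsub>U\<^esub> h U (x, y, y') \<cdot>\<^bsub>U\<^esub> a'' \<cdot>\<^bsub>U\<^esub> h U (x, y \<^bold>+\<^bsub>U\<^esub> y', y'')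
        = a \<cdot>\<^bsub>U\<^esub> (a' \<cdot>\<^bsub>U\<^esub> a'' \<cdot>\<^bsub>U\<^esub> h U (x, y', y'')) \<cdot>\<^bsub>U\<^esub> h U (x, y, y' \<^bold>+\<^bsub>U\<^esub> y'')
      \<longleftrightarrow> h U (x, y', y'') \<cdot>\<^bsub>U\<^esub> h U (x, y, y' \<^bold>+\<^bsub>U\<^esub> y'') = h U (x, y \<^bold>+\<^bsub>U\<^esub> y', y'') \<cdot>\<^bsub>U\<^esub> h U (x, y, y')"
      if "x \<in> B_sec U" "y \<in> B_sec U" "y' \<in> B_sec U" "y'' \<in> B_sec U" "a \<in> A_sec U" "a' \<in> A_sec U" "a'' \<in> A_sec U"
      for x y y' y'' a a' a''
      by (subst eq_commute, rule A.cancel_iff [of "a \<cdot>\<^bsub>U\<^esub> a' \<cdot>\<^bsub>U\<^esub> a''"]) (use that in \<open>simp_all add: A.m_ac\<close>)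
    have comm: "a \<cdot>\<^bsub>U\<^esub> a' \<cdot>\<^bsub>U\<^esub> c = a' \<cdot>\<^bsub>U\<^esub> a \<cdot>\<^bsub>U\<^esub> c' \<longleftrightarrow> c = c'"
      if "a \<in> A_sec U" "a' \<in> A_sec U" "c \<in> A_sec U" "c' \<in> A_sec U" for a a' c c'
      using that by (simp add: A.m_comm [of a a'])
    have inter: "a \<cdot>\<^bsub>U\<^esub> b \<cdot>\<^bsub>U\<^esub> g1 \<cdot>\<^bsub>U\<^esub> (c \<cdot>\<^bsub>U\<^esub> d \<cdot>\<^bsub>U\<^esub> g2) \<cdot>\<^bsub>U\<^esub> h3
        = a \<cdot>\<^bsub>U\<^esub> c \<cdot>\<^bsub>U\<^esub> h1 \<cdot>\<^bsub>U\<^esub> (b \<cdot>\<^bsub>U\<^esub> d \<cdot>\<^bsub>U\<^esub> h2) \<cdot>\<^bsub>U\<^esub> g3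
      \<longleftrightarrow> h3 \<cdot>\<^bsub>U\<^esub> (g1 \<cdot>\<^bsub>U\<^esub> g2) = g3 \<cdot>\<^bsub>U\<^esub> (h1 \<cdot>\<^bsub>U\<^esub> h2)"
      if "a \<in> A_sec U" "b \<in> A_sec U" "c \<in> A_sec U" "d \<in> A_sec U" "g1 \<in> A_sec U" "g2 \<in> A_sec U"
        "g3 \<in> A_sec U" "h1 \<in> A_sec U" "h2 \<in> A_sec U" "h3 \<in> A_sec U"
      for a b c d g1 g2 g3 h1 h2 h3
      by (rule A.cancel_iff [of "a \<cdot>\<^bsub>U\<^esub> b \<cdot>\<^bsub>U\<^esub> c \<cdot>\<^bsub>U\<^esub> d"]) (use that in \<open>simp_all add: A.m_ac\<close>)
    \<comment> \<open>In the form of an equivalence with \<open>True\<close> this discharges the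
      equation between sums instead of reordering sums elsewhere.\<close>
    have [simp]: "x \<^bold>+\<^bsub>U\<^esub> y = y \<^bold>+\<^bsub>U\<^esub> x \<longleftrightarrow> True" if "x \<in> B_sec U" "y \<in> B_sec U" for x y
      using that by (simp add: B.m_comm)
    show ?thesis
      unfolding biext_cocycles_def
      by (simp add: fib_trivial assoc1 assoc2 comm inter B.m_assoc ball_conj_distrib) blast
  qed
  note main = this
  show ?thesis
    unfolding biextension_def ball_conj_distrib [symmetric]
    using torsor_trivial P1_Mor P2_Mor t1 t2 main by (auto 0 0)
qed

end

section \<open>The symmetry and cube structures\<close>

locale trivial_section = trivial_laws T A B P1 P2 g h
  for T :: "('o, 'm) site_data" and A :: "('o, 'm, 'a) group_sheaf" and B :: "('o, 'm, 'b) group_sheaf"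
    and P1 P2 :: "'o \<Rightarrow> ('a \<times> 'b \<times> 'b) \<times> ('a \<times> 'b \<times> 'b) \<Rightarrow> 'a \<times> 'b \<times> 'b"
    and g h :: "'o \<Rightarrow> 'b \<times> 'b \<times> 'b \<Rightarrow> 'a" +
  fixes t :: "'o \<Rightarrow> 'b \<Rightarrow> 'a \<times> 'b \<times> 'b" and u :: "'o \<Rightarrow> 'b \<Rightarrow> 'a"
  assumes t_Mor: "t \<in> Mor T (und B) (Tot \<E>)"
    and u_Mor: "u \<in> Mor T (und B) (und A)"
    and t_apply [simp]: "\<lbrakk>U \<in> Ob T; x \<in> B_sec U\<rbrakk> \<Longrightarrow> t U x = (u U x, x, x)"
begin

lemmas u_closed [simp] = Mor1_closed [OF u_Mor]

text \<open>Membership in \<open>sigma_graph\<close> with the auxiliary \<open>c\<close> and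
  \<open>\<alpha>\<close> eliminated. The factors with argument \<open>B_zero U\<close> come from
  the neutral sections, which differ from the base points.\<close>

definition sigma_eq :: "'o \<Rightarrow> 'b \<Rightarrow> bool" where
  "sigma_eq U x \<longleftrightarrow> u U (B_neg U x) \<cdot>\<^bsub>U\<^esub> g U (B_neg U x, x, B_neg U x) \<cdot>\<^bsub>U\<^esub> g U (B_zero U, B_zero U, B_neg U x)
     = u U x \<cdot>\<^bsub>U\<^esub> h U (x, B_neg U x, x) \<cdot>\<^bsub>U\<^esub> h U (x, B_zero U, B_zero U)"

abbreviation lam3_at :: "'o \<Rightarrow> 'b \<Rightarrow> 'b \<Rightarrow> 'b \<Rightarrow> 'a" where
  "lam3_at U \<equiv> law_pair.lam3 (grp A U) (grp B U) (g U) (h U)"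

abbreviation lam2_at :: "'o \<Rightarrow> 'b \<Rightarrow> 'b \<Rightarrow> 'a" where
  "lam2_at U \<equiv> law_pair.lam2 (grp A U) (grp B U) (g U) (h U)"

text \<open>Membership in \<open>cube_graph\<close> with the auxiliary sections eliminated:
  \<open>lam3\<close> is the cost of one ninefold sum, the three \<open>lam2\<close> factors that of
  the three fourfold sums, and cross-multiplication puts each on the opposite side.\<close>

definition cube_eq :: "'o \<Rightarrow> 'b \<Rightarrow> 'b \<Rightarrow> 'b \<Rightarrow> bool" where
  "cube_eq U x y z \<longleftrightarrow>
     u U (x \<^bold>+\<^bsub>U\<^esub> y \<^bold>+\<^bsub>U\<^esub> z) \<cdot>\<^bsub>U\<^esub> u U x \<cdot>\<^bsub>U\<^esub> u U y \<cdot>\<^bsub>U\<^esub> u U z \<cdot>\<^bsub>U\<^esub> (lam2_at U x y \<cdot>\<^bsub>U\<^esub> lam2_at U x z \<cdot>\<^bsub>U\<^esub> lam2_at U y z)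
     = u U (x \<^bold>+\<^bsub>U\<^esub> y) \<cdot>\<^bsub>U\<^esub> u U (x \<^bold>+\<^bsub>U\<^esub> z) \<cdot>\<^bsub>U\<^esub> u U (y \<^bold>+\<^bsub>U\<^esub> z) \<cdot>\<^bsub>U\<^esub> lam3_at U x y z"

lemma sigma_graph_iff:
  assumes U: "U \<in> Ob T" and x: "x \<in> B_sec U"
  shows "(t U (B_neg U x), t U x) \<in> sigma_graph \<E> P1 P2 U x \<longleftrightarrow> sigma_eq U x"
proof -
  interpret A: comm_group "grp A U" by (rule A_comm_group [OF U])
  interpret B: comm_group "grp B U" by (rule B_comm_group [OF U])
  note U [simp] x [simp]
  let ?m = "B_neg U x" and ?n = "B_zero U"
  let ?gn = "g U (?n, ?n, ?m)" and ?hn = "h U (x, ?n, ?n)"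
  let ?g = "g U (?m, x, ?m)" and ?h = "h U (x, ?m, x)"
  \<comment> \<open>The neutral sections of \<open>E\<^sub>0\<^sub>,\<^sub>-\<^sub>x\<close> and \<open>E\<^sub>x\<^sub>,\<^sub>0\<close> are the inverses of \<open>?gn\<close> and \<open>?hn\<close>.\<close>
  have idem: "e \<cdot>\<^bsub>U\<^esub> e \<cdot>\<^bsub>U\<^esub> k = e \<longleftrightarrow> e = inv\<^bsub>grp A U\<^esub> k" if "e \<in> A_sec U" "k \<in> A_sec U" for e k
  proof -
    have "e \<cdot>\<^bsub>U\<^esub> e \<cdot>\<^bsub>U\<^esub> k = e \<longleftrightarrow> e \<cdot>\<^bsub>U\<^esub> k = A_one U"
      using that A.l_cancel_one [of "e" "e \<cdot>\<^bsub>U\<^esub> k"] by (simp add: A.m_assoc)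
    also have "\<dots> \<longleftrightarrow> e = inv\<^bsub>grp A U\<^esub> k"
      using that A.inv_equality [of e k] by auto
    finally show ?thesis .
  qed
  have "(t U ?m, t U x) \<in> sigma_graph \<E> P1 P2 U x \<longleftrightarrow>
      (\<exists>c\<in>A_sec U. \<exists>\<alpha>\<in>A_sec U. u U ?m \<cdot>\<^bsub>U\<^esub> c \<cdot>\<^bsub>U\<^esub> ?g = \<alpha> \<^bold>/\<^bsub>U\<^esub> ?gn \<and> c \<cdot>\<^bsub>U\<^esub> u U x \<cdot>\<^bsub>U\<^esub> ?h = \<alpha> \<^bold>/\<^bsub>U\<^esub> ?hn)"
    unfolding sigma_graph_def
    by (simp add: fib_trivial image_iff idem)
  also have "\<dots> \<longleftrightarrow> sigma_eq U x"
  proof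
    assume "\<exists>c\<in>A_sec U. \<exists>\<alpha>\<in>A_sec U. u U ?m \<cdot>\<^bsub>U\<^esub> c \<cdot>\<^bsub>U\<^esub> ?g = \<alpha> \<^bold>/\<^bsub>U\<^esub> ?gn \<and> c \<cdot>\<^bsub>U\<^esub> u U x \<cdot>\<^bsub>U\<^esub> ?h = \<alpha> \<^bold>/\<^bsub>U\<^esub> ?hn"
    then obtain c \<alpha> where c: "c \<in> A_sec U" "\<alpha> \<in> A_sec U"
      and 1: "\<alpha> \<^bold>/\<^bsub>U\<^esub> ?gn = u U ?m \<cdot>\<^bsub>U\<^esub> c \<cdot>\<^bsub>U\<^esub> ?g" and 2: "\<alpha> \<^bold>/\<^bsub>U\<^esub> ?hn = c \<cdot>\<^bsub>U\<^esub> u U x \<cdot>\<^bsub>U\<^esub> ?h" by metis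
    have "u U ?m \<cdot>\<^bsub>U\<^esub> c \<cdot>\<^bsub>U\<^esub> ?g \<cdot>\<^bsub>U\<^esub> ?gn = c \<cdot>\<^bsub>U\<^esub> u U x \<cdot>\<^bsub>U\<^esub> ?h \<cdot>\<^bsub>U\<^esub> ?hn"
      using 1 2 c by (simp add: A.div_eq_iff)
    then have "c \<cdot>\<^bsub>U\<^esub> (u U ?m \<cdot>\<^bsub>U\<^esub> ?g \<cdot>\<^bsub>U\<^esub> ?gn) = c \<cdot>\<^bsub>U\<^esub> (u U x \<cdot>\<^bsub>U\<^esub> ?h \<cdot>\<^bsub>U\<^esub> ?hn)"
      using c by (simp add: A.m_ac)
    then show "sigma_eq U x" using c by (simp add: sigma_eq_def)
  next
    assume *: "sigma_eq U x"
    show "\<exists>c\<in>A_sec U. \<exists>\<alpha>\<in>A_sec U. u U ?m \<cdot>\<^bsub>U\<^esub> c \<cdot>\<^bsub>U\<^esub> ?g = \<alpha> \<^bold>/\<^bsub>U\<^esub> ?gn \<and> c \<cdot>\<^bsub>U\<^esub> u U x \<cdot>\<^bsub>U\<^esub> ?h = \<alpha> \<^bold>/\<^bsub>U\<^esub> ?hn"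
    \<comment> \<open>Since \<open>c\<close> cancels, it may be 1; the first equation then forces
      \<open>\<alpha>\<close>, and the second becomes \<open>sigma_eq\<close>.\<close>
    proof (intro bexI conjI)
      show "u U ?m \<cdot>\<^bsub>U\<^esub> A_one U \<cdot>\<^bsub>U\<^esub> ?g = u U ?m \<cdot>\<^bsub>U\<^esub> ?g \<cdot>\<^bsub>U\<^esub> ?gn \<^bold>/\<^bsub>U\<^esub> ?gn" by (simp add: A.m_assoc)
      show "A_one U \<cdot>\<^bsub>U\<^esub> u U x \<cdot>\<^bsub>U\<^esub> ?h = u U ?m \<cdot>\<^bsub>U\<^esub> ?g \<cdot>\<^bsub>U\<^esub> ?gn \<^bold>/\<^bsub>U\<^esub> ?hn"
        using * by (simp add: sigma_eq_def A.m_assoc)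
    qed simp_all
  qed
  finally show ?thesis .
qed

section \<open>The cube structure in coordinates\<close>

lemma sum4_trivial:
  assumes U: "U \<in> Ob T" and "x \<in> B_sec U" "y \<in> B_sec U"
    and "a \<in> A_sec U" "b \<in> A_sec U" "c \<in> A_sec U" "d \<in> A_sec U"
  shows "sum4 P1 P2 U (a, x, x) (b, x, y) (c, y, x) (d, y, y)
    = (a \<cdot>\<^bsub>U\<^esub> b \<cdot>\<^bsub>U\<^esub> c \<cdot>\<^bsub>U\<^esub> d \<cdot>\<^bsub>U\<^esub> lam2_at U x y, x \<^bold>+\<^bsub>U\<^esub> y, x \<^bold>+\<^bsub>U\<^esub> y)"
proof -
  interpret law_pair "grp A U" "grp B U" "g U" "h U" by (rule law_pair_at [OF U])
  show ?thesis using assms by (simp add: sum4_def lam2_def A.m_ac)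
qed

lemma sum9_trivial:
  assumes U: "U \<in> Ob T" and "x \<in> B_sec U" "y \<in> B_sec U" "z \<in> B_sec U"
    and "axx \<in> A_sec U" "axy \<in> A_sec U" "axz \<in> A_sec U" "ayx \<in> A_sec U" "ayy \<in> A_sec U" "ayz \<in> A_sec U"
    "azx \<in> A_sec U" "azy \<in> A_sec U" "azz \<in> A_sec U"
  shows "sum9 P1 P2 U (axx, x, x) (axy, x, y) (axz, x, z) (ayx, y, x) (ayy, y, y) (ayz, y, z)
      (azx, z, x) (azy, z, y) (azz, z, z)
    = (axx \<cdot>\<^bsub>U\<^esub> axy \<cdot>\<^bsub>U\<^esub> axz \<cdot>\<^bsub>U\<^esub> (ayx \<cdot>\<^bsub>U\<^esub> ayy \<cdot>\<^bsub>U\<^esub> ayz) \<cdot>\<^bsub>U\<^esub> (azx \<cdot>\<^bsub>U\<^esub> azy \<cdot>\<^bsub>U\<^esub> azz) \<cdot>\<^bsub>U\<^esub> lam3_at U x y z,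
       x \<^bold>+\<^bsub>U\<^esub> y \<^bold>+\<^bsub>U\<^esub> z, x \<^bold>+\<^bsub>U\<^esub> y \<^bold>+\<^bsub>U\<^esub> z)"
proof -
  interpret law_pair "grp A U" "grp B U" "g U" "h U" by (rule law_pair_at [OF U])
  show ?thesis using assms by (simp add: sum9_def lam3_def A.m_ac)
qed

text \<open>Let p be the product of the \<open>A\<close>-components of the twelve auxiliary
  sections. Each of them occurs once in either wedge, so membership says that the product of the
  four \<open>u\<close> values is p times \<open>lam3\<close>, and that of the three
  \<open>u\<close> values is p times the \<open>lam2\<close> factors. Eliminating p gives
  \<open>cube_eq\<close>.\<close>

lemma cube_graph_iff:
  assumes U: "U \<in> Ob T" and x: "x \<in> B_sec U" and y: "y \<in> B_sec U" and z: "z \<in> B_sec U"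
  shows "(wedge \<E> U [t U (x \<^bold>+\<^bsub>U\<^esub> y \<^bold>+\<^bsub>U\<^esub> z), t U x, t U y, t U z],
      wedge \<E> U [t U (x \<^bold>+\<^bsub>U\<^esub> y), t U (x \<^bold>+\<^bsub>U\<^esub> z), t U (y \<^bold>+\<^bsub>U\<^esub> z)]) \<in> cube_graph \<E> P1 P2 U x y z
    \<longleftrightarrow> cube_eq U x y z" (is "(?W, ?W') \<in> _ \<longleftrightarrow> _")
proof -
  interpret law_pair "grp A U" "grp B U" "g U" "h U" by (rule law_pair_at [OF U])
  note U [simp] x [simp] y [simp] z [simp]
  let ?l = "lam2_at U x y \<cdot>\<^bsub>U\<^esub> lam2_at U x z \<cdot>\<^bsub>U\<^esub> lam2_at U y z"
  let ?u = "u U (x \<^bold>+\<^bsub>U\<^esub> y \<^bold>+\<^bsub>U\<^esub> z) \<cdot>\<^bsub>U\<^esub> u U x \<cdot>\<^bsub>U\<^esub> u U y \<cdot>\<^bsub>U\<^esub> u U z"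
  let ?u' = "u U (x \<^bold>+\<^bsub>U\<^esub> y) \<cdot>\<^bsub>U\<^esub> u U (x \<^bold>+\<^bsub>U\<^esub> z) \<cdot>\<^bsub>U\<^esub> u U (y \<^bold>+\<^bsub>U\<^esub> z)"
  have W: "?W = wedge \<E> U [(a, x \<^bold>+\<^bsub>U\<^esub> y \<^bold>+\<^bsub>U\<^esub> z, x \<^bold>+\<^bsub>U\<^esub> y \<^bold>+\<^bsub>U\<^esub> z), (b, x, x), (c, y, y), (d, z, z)]
      \<longleftrightarrow> ?u = a \<cdot>\<^bsub>U\<^esub> b \<cdot>\<^bsub>U\<^esub> c \<cdot>\<^bsub>U\<^esub> d"
    if "a \<in> A_sec U" "b \<in> A_sec U" "c \<in> A_sec U" "d \<in> A_sec U" for a b c d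
    using that by (subst wedge_trivial_eq_iff) (simp_all add: A.m_assoc)
  have W': "?W' = wedge \<E> U [(a, x \<^bold>+\<^bsub>U\<^esub> y, x \<^bold>+\<^bsub>U\<^esub> y), (b, x \<^bold>+\<^bsub>U\<^esub> z, x \<^bold>+\<^bsub>U\<^esub> z), (c, y \<^bold>+\<^bsub>U\<^esub> z, y \<^bold>+\<^bsub>U\<^esub> z)]
      \<longleftrightarrow> ?u' = a \<cdot>\<^bsub>U\<^esub> b \<cdot>\<^bsub>U\<^esub> c"
    if "a \<in> A_sec U" "b \<in> A_sec U" "c \<in> A_sec U" for a b c
    using that by (subst wedge_trivial_eq_iff) (simp_all add: A.m_assoc)
  show ?thesis
  proof
    assume "(?W, ?W') \<in> cube_graph \<E> P1 P2 U x y z"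
    then obtain exx exy exz eyx eyy eyz ezx ezy ezz nx ny nz where
      W_eq: "?W = wedge \<E> U [sum9 P1 P2 U exx exy exz eyx eyy eyz ezx ezy ezz, nx, ny, nz]" and
      W'_eq: "?W' = wedge \<E> U [sum4 P1 P2 U exx exy eyx eyy, sum4 P1 P2 U nx exz ezx ezz,
        sum4 P1 P2 U ny eyz ezy nz]" and
      e: "exx \<in> fib \<E> U x x" "exy \<in> fib \<E> U x y" "exz \<in> fib \<E> U x z"
        "eyx \<in> fib \<E> U y x" "eyy \<in> fib \<E> U y y" "eyz \<in> fib \<E> U y z"
        "ezx \<in> fib \<E> U z x" "ezy \<in> fib \<E> U z y" "ezz \<in> fib \<E> U z z"
        "nx \<in> fib \<E> U x x" "ny \<in> fib \<E> U y y" "nz \<in> fib \<E> U z z"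
      unfolding cube_graph_def by (elim CollectE exE conjE Pair_inject) (rule that)
    have fibE: thesis if "e \<in> fib \<E> U p q" "p \<in> B_sec U" "q \<in> B_sec U"
        "\<And>a. \<lbrakk>a \<in> A_sec U; e = (a, p, q)\<rbrakk> \<Longrightarrow> thesis" for e p q thesis
      using that by (auto simp: fib_trivial)
    from e obtain axx axy axz ayx ayy ayz azx azy azz bx by' bz where
      e_eq: "exx = (axx, x, x)" "exy = (axy, x, y)" "exz = (axz, x, z)"
        "eyx = (ayx, y, x)" "eyy = (ayy, y, y)" "eyz = (ayz, y, z)"
        "ezx = (azx, z, x)" "ezy = (azy, z, y)" "ezz = (azz, z, z)"
        "nx = (bx, x, x)" "ny = (by', y, y)" "nz = (bz, z, z)" and
      a [simp]: "axx \<in> A_sec U" "axy \<in> A_sec U" "axz \<in> A_sec U" "ayx \<in> A_sec U" "ayy \<in> A_sec U"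
        "ayz \<in> A_sec U" "azx \<in> A_sec U" "azy \<in> A_sec U" "azz \<in> A_sec U"
        "bx \<in> A_sec U" "by' \<in> A_sec U" "bz \<in> A_sec U"
      by (elim fibE [OF _ x x] fibE [OF _ x y] fibE [OF _ x z] fibE [OF _ y x] fibE [OF _ y y]
        fibE [OF _ y z] fibE [OF _ z x] fibE [OF _ z y] fibE [OF _ z z]) (rule that)
    note W_eq W'_eq
    then have "?u = axx \<cdot>\<^bsub>U\<^esub> axy \<cdot>\<^bsub>U\<^esub> axz \<cdot>\<^bsub>U\<^esub> (ayx \<cdot>\<^bsub>U\<^esub> ayy \<cdot>\<^bsub>U\<^esub> ayz) \<cdot>\<^bsub>U\<^esub> (azx \<cdot>\<^bsub>U\<^esub> azy \<cdot>\<^bsub>U\<^esub> azz)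
        \<cdot>\<^bsub>U\<^esub> lam3_at U x y z \<cdot>\<^bsub>U\<^esub> bx \<cdot>\<^bsub>U\<^esub> by' \<cdot>\<^bsub>U\<^esub> bz"
      and "?u' = axx \<cdot>\<^bsub>U\<^esub> axy \<cdot>\<^bsub>U\<^esub> ayx \<cdot>\<^bsub>U\<^esub> ayy \<cdot>\<^bsub>U\<^esub> lam2_at U x y
        \<cdot>\<^bsub>U\<^esub> (bx \<cdot>\<^bsub>U\<^esub> axz \<cdot>\<^bsub>U\<^esub> azx \<cdot>\<^bsub>U\<^esub> azz \<cdot>\<^bsub>U\<^esub> lam2_at U x z) \<cdot>\<^bsub>U\<^esub> (by' \<cdot>\<^bsub>U\<^esub> ayz \<cdot>\<^bsub>U\<^esub> azy \<cdot>\<^bsub>U\<^esub> bz \<cdot>\<^bsub>U\<^esub> lam2_at U y z)"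
      unfolding e_eq
      by (simp_all only: sum9_trivial [OF U x y z] sum4_trivial [OF U] x y z a W W' A_closed U
          lam2_closed lam3_closed)
    then show "cube_eq U x y z"
      unfolding cube_eq_def by (simp only:) (simp add: A.m_ac)
  next
    assume *: "cube_eq U x y z"
    \<comment> \<open>Only the product of the twelve auxiliary sections matters, so all but one can be \<open>1\<close>.\<close>
    let ?a = "?u' \<^bold>/\<^bsub>U\<^esub> ?l"
    have a: "?a \<in> A_sec U" "?u' = ?a \<cdot>\<^bsub>U\<^esub> ?l" by (simp_all add: A.m_assoc)
    have "?u = ?a \<cdot>\<^bsub>U\<^esub> lam3_at U x y z"
    proof -
      have "?l \<cdot>\<^bsub>U\<^esub> ?u = ?u' \<cdot>\<^bsub>U\<^esub> lam3_at U x y z"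
        using * unfolding cube_eq_def by (simp add: A.m_comm)
      also have "\<dots> = ?l \<cdot>\<^bsub>U\<^esub> (?a \<cdot>\<^bsub>U\<^esub> lam3_at U x y z)"
        using a(1) by (subst a(2)) (simp add: A.m_ac)
      finally show ?thesis using a(1) by simp
    qed
    define a where "a = ?a"
    have u: "?u = a \<cdot>\<^bsub>U\<^esub> lam3_at U x y z" and u': "?u' = a \<cdot>\<^bsub>U\<^esub> ?l" and a_closed [simp]: "a \<in> A_sec U"
      using a \<open>?u = _\<close> unfolding a_def by blast+
    let ?one = "A_one U"
    \<comment> \<open>\<open>t_apply\<close> is held back here and below because \<open>W\<close>
      and \<open>W'\<close> match on terms in \<open>t\<close>.\<close>
    have "?W = wedge \<E> U [sum9 P1 P2 U (a, x, x) (?one, x, y) (?one, x, z) (?one, y, x) (?one, y, y)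
        (?one, y, z) (?one, z, x) (?one, z, y) (?one, z, z), (?one, x, x), (?one, y, y), (?one, z, z)]"
      by (simp add: sum9_trivial W u del: t_apply)
    moreover have "?W' = wedge \<E> U [sum4 P1 P2 U (a, x, x) (?one, x, y) (?one, y, x) (?one, y, y),
        sum4 P1 P2 U (?one, x, x) (?one, x, z) (?one, z, x) (?one, z, z),
        sum4 P1 P2 U (?one, y, y) (?one, y, z) (?one, z, y) (?one, z, z)]"
      by (simp add: sum4_trivial W' u' del: t_apply) (simp add: A.m_assoc)
    moreover have "(?one, p, q) \<in> fib \<E> U p q" "(a, p, q) \<in> fib \<E> U p q" if "p \<in> B_sec U" "q \<in> B_sec U" for p q
      using that by (simp_all add: fib_trivial)
    ultimately show "(?W, ?W') \<in> cube_graph \<E> P1 P2 U x y z"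
      unfolding cube_graph_def using x y z by blast
  qed
qed

text \<open>The source of (6). Both classes consist of the pairs over (x, y) and (y, x) whose
  \<open>A\<close>-components have a prescribed product: it is \<open>p\<close> for the wedge, and
  for \<open>antisym\<close> it is the solution of an equation obtained from
  \<open>sum4_trivial\<close>. The classes agree exactly when \<open>p\<close> solves that
  equation.\<close>

lemma antisym_iff:
  assumes U: "U \<in> Ob T" and x: "x \<in> B_sec U" and y: "y \<in> B_sec U" and p: "p \<in> A_sec U"
  shows "antisym \<E> P1 P2 t U x y = wedge \<E> U [(p, x, y), (A_one U, y, x)]
    \<longleftrightarrow> u U (x \<^bold>+\<^bsub>U\<^esub> y) = lam2_at U x y \<cdot>\<^bsub>U\<^esub> p \<cdot>\<^bsub>U\<^esub> (u U x \<cdot>\<^bsub>U\<^esub> u U y)"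
proof -
  interpret law_pair "grp A U" "grp B U" "g U" "h U" by (rule law_pair_at [OF U])
  note U [simp] x [simp] y [simp] p [simp]
  let ?K = "lam2_at U x y \<cdot>\<^bsub>U\<^esub> (u U x \<cdot>\<^bsub>U\<^esub> u U y)"
  have sum4: "t U (x \<^bold>+\<^bsub>U\<^esub> y) = sum4 P1 P2 U (t U x) (b, x, y) (c, y, x) (t U y)
      \<longleftrightarrow> u U (x \<^bold>+\<^bsub>U\<^esub> y) = ?K \<cdot>\<^bsub>U\<^esub> (b \<cdot>\<^bsub>U\<^esub> c)" if "b \<in> A_sec U" "c \<in> A_sec U" for b c
    using that by (simp add: sum4_trivial A.m_ac)
  have antisym: "antisym \<E> P1 P2 t U x y = {[(b, x, y), (c, y, x)] | b c. b \<in> A_sec U \<and> c \<in> A_sec U \<and>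
      u U (x \<^bold>+\<^bsub>U\<^esub> y) = ?K \<cdot>\<^bsub>U\<^esub> (b \<cdot>\<^bsub>U\<^esub> c)}"
    unfolding antisym_def fib_trivial [OF U x y] fib_trivial [OF U y x] using sum4 by blast
  have wedge: "wedge \<E> U [(p, x, y), (A_one U, y, x)] = {[(b, x, y), (c, y, x)] | b c. b \<in> A_sec U \<and> c \<in> A_sec U \<and>
      b \<cdot>\<^bsub>U\<^esub> c = p}" (is "_ = ?R")
  proof (rule Set.set_eqI)
    fix es
    have "es \<in> wedge \<E> U [(p, x, y), (A_one U, y, x)] \<longleftrightarrow> set es \<subseteq> A_sec U \<times> B_sec U \<times> B_sec U \<and>
        map snd es = [(x, y), (y, x)] \<and> foldr (\<lambda>a b. a \<cdot>\<^bsub>U\<^esub> b) (map fst es) (A_one U) = p"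
      by (subst mem_wedge_trivial) simp_all
    also have "\<dots> \<longleftrightarrow> es \<in> ?R"
      by (auto simp: map_eq_Cons_conv)
    finally show "es \<in> wedge \<E> U [(p, x, y), (A_one U, y, x)] \<longleftrightarrow> es \<in> ?R" .
  qed
  show ?thesis
  proof
    assume "antisym \<E> P1 P2 t U x y = wedge \<E> U [(p, x, y), (A_one U, y, x)]"
    \<comment> \<open>One representative suffices: it carries the value \<open>p\<close> into the
      equation defining \<open>antisym\<close>.\<close>
    moreover have "[(p, x, y), (A_one U, y, x)] \<in> wedge \<E> U [(p, x, y), (A_one U, y, x)]"
      unfolding wedge by simp
    ultimately have "[(p, x, y), (A_one U, y, x)] \<in> antisym \<E> P1 P2 t U x y" by blast
    then have "u U (x \<^bold>+\<^bsub>U\<^esub> y) = ?K \<cdot>\<^bsub>U\<^esub> (p \<cdot>\<^bsub>U\<^esub> A_one U)"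
      unfolding antisym by blast
    then show "u U (x \<^bold>+\<^bsub>U\<^esub> y) = lam2_at U x y \<cdot>\<^bsub>U\<^esub> p \<cdot>\<^bsub>U\<^esub> (u U x \<cdot>\<^bsub>U\<^esub> u U y)" by (simp add: A.m_ac)
  next
    assume "u U (x \<^bold>+\<^bsub>U\<^esub> y) = lam2_at U x y \<cdot>\<^bsub>U\<^esub> p \<cdot>\<^bsub>U\<^esub> (u U x \<cdot>\<^bsub>U\<^esub> u U y)"
    then have u: "u U (x \<^bold>+\<^bsub>U\<^esub> y) = ?K \<cdot>\<^bsub>U\<^esub> p" by (simp add: A.m_ac)
    have "u U (x \<^bold>+\<^bsub>U\<^esub> y) = ?K \<cdot>\<^bsub>U\<^esub> (b \<cdot>\<^bsub>U\<^esub> c) \<longleftrightarrow> b \<cdot>\<^bsub>U\<^esub> c = p" if "b \<in> A_sec U" "c \<in> A_sec U" for b c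
      unfolding u using that by auto
    then show "antisym \<E> P1 P2 t U x y = wedge \<E> U [(p, x, y), (A_one U, y, x)]"
      unfolding antisym wedge by blast
  qed
qed

text \<open>Turns a condition required on a covering into one equation over \<open>U\<close>.
  Separatedness of \<open>A\<close> gives one direction; in the other, the equation restricts along
  every arrow, so the maximal sieve works.\<close>

lemma locally_iff:
  assumes U: "U \<in> Ob T"
    and "a \<in> A_sec U" "b \<in> A_sec U"
    and Q: "\<And>f. \<lbrakk>f \<in> Ar T; tgt T f = U\<rbrakk> \<Longrightarrow> Q f \<longleftrightarrow> gres A f a = gres A f b"
  shows "(\<exists>S\<in>Cov T U. \<forall>f\<in>S. Q f) \<longleftrightarrow> a = b"
proof
  assume "\<exists>S\<in>Cov T U. \<forall>f\<in>S. Q f"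
  then obtain S where S: "S \<in> Cov T U" "\<And>f. f \<in> S \<Longrightarrow> Q f" by blast
  have "sieve T U S" by (rule Cov_sieve [OF U S(1)])
  then have "f \<in> Ar T \<and> tgt T f = U" if "f \<in> S" for f using that by (auto simp: sieve_def)
  then have "gres A f a = gres A f b" if "f \<in> S" for f using that S(2) Q by blast
  then show "a = b"
    using assms(1-3) S(1) \<open>sieve T U S\<close> by - (rule sheaf_separated [OF sheaf_A, of U S], simp_all)
next
  assume "a = b"
  then show "\<exists>S\<in>Cov T U. \<forall>f\<in>S. Q f"
    by (intro bexI [OF _ Cov_maximal [OF U]] ballI) (simp add: Q)
qed

lemma alternating_biextension_iff:
  "alternating_biextension \<E> P1 P2 t \<longleftrightarrow> (\<forall>U\<in>Ob T. biext_cocycles g h U \<and>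
     (\<forall>x\<in>B_sec U. sigma_eq U x) \<and> (\<forall>x\<in>B_sec U. \<forall>y\<in>B_sec U. \<forall>z\<in>B_sec U. cube_eq U x y z))"
proof -
  note natural = Mor1_natural [OF u_Mor] Mor3_natural [OF g_Mor] Mor3_natural [OF h_Mor]
  have t: "\<forall>U\<in>Ob T. \<forall>x\<in>B_sec U. t U x \<in> fib \<E> U x x" by (simp add: fib_trivial)
  have sigma: "(\<exists>S\<in>Cov T U. \<forall>f\<in>S. let V = src T f; x' = gres B f x
        in (t V (B_neg V x'), t V x') \<in> sigma_graph \<E> P1 P2 V x') \<longleftrightarrow> sigma_eq U x"
    if U: "U \<in> Ob T" and x: "x \<in> B_sec U" for U x
    unfolding sigma_eq_def Let_def
  proof (rule locally_iff [OF U])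
    fix f assume f: "f \<in> Ar T" "tgt T f = U"
    have "(t (src T f) (B_neg (src T f) (gres B f x)), t (src T f) (gres B f x))
        \<in> sigma_graph \<E> P1 P2 (src T f) (gres B f x) \<longleftrightarrow> sigma_eq (src T f) (gres B f x)"
      using f x src_Ob by (intro sigma_graph_iff) auto
    then show "(t (src T f) (B_neg (src T f) (gres B f x)), t (src T f) (gres B f x))
        \<in> sigma_graph \<E> P1 P2 (src T f) (gres B f x) \<longleftrightarrow>
      gres A f (u U (B_neg U x) \<cdot>\<^bsub>U\<^esub> g U (B_neg U x, x, B_neg U x) \<cdot>\<^bsub>U\<^esub> g U (B_zero U, B_zero U, B_neg U x))
      = gres A f (u U x \<cdot>\<^bsub>U\<^esub> h U (x, B_neg U x, x) \<cdot>\<^bsub>U\<^esub> h U (x, B_zero U, B_zero U))"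
      \<comment> \<open>Writing \<open>U\<close> as the target of \<open>f\<close> brings the goal
        into the form in which the restriction rules are stated.\<close>
      using f(1) x U unfolding f(2) [symmetric] by (simp add: sigma_eq_def natural)
  qed (use U x in simp_all)
  have cube: "(\<exists>S\<in>Cov T U. \<forall>f\<in>S.
        let V = src T f; x' = gres B f x; y' = gres B f y; z' = gres B f z
        in (wedge \<E> V [t V (x' \<^bold>+\<^bsub>V\<^esub> y' \<^bold>+\<^bsub>V\<^esub> z'), t V x', t V y', t V z'],
            wedge \<E> V [t V (x' \<^bold>+\<^bsub>V\<^esub> y'), t V (x' \<^bold>+\<^bsub>V\<^esub> z'), t V (y' \<^bold>+\<^bsub>V\<^esub> z')])
           \<in> cube_graph \<E> P1 P2 V x' y' z') \<longleftrightarrow> cube_eq U x y z"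
    if U: "U \<in> Ob T" and x: "x \<in> B_sec U" and y: "y \<in> B_sec U" and z: "z \<in> B_sec U" for U x y z
    unfolding cube_eq_def Let_def
  proof (rule locally_iff [OF U])
    fix f assume f: "f \<in> Ar T" "tgt T f = U"
    let ?V = "src T f"
    let ?x = "gres B f x" and ?y = "gres B f y" and ?z = "gres B f z"
    have V: "?V \<in> Ob T" using f by (simp add: src_Ob)
    note law_pair_at [OF U] law_pair_at [OF V]
    \<comment> \<open>\<open>lam2\<close> and \<open>lam3\<close> are unfolded over both objects:
      they commute with restriction because they are products of values of the natural maps
      \<open>g\<close> and \<open>h\<close>.\<close>
    note lam = law_pair.lam2_def [OF this(1)] law_pair.lam2_def [OF this(2)]
      law_pair.lam3_def [OF this(1)] law_pair.lam3_def [OF this(2)]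
    have "(wedge \<E> ?V [t ?V (?x \<^bold>+\<^bsub>?V\<^esub> ?y \<^bold>+\<^bsub>?V\<^esub> ?z), t ?V ?x, t ?V ?y, t ?V ?z],
            wedge \<E> ?V [t ?V (?x \<^bold>+\<^bsub>?V\<^esub> ?y), t ?V (?x \<^bold>+\<^bsub>?V\<^esub> ?z), t ?V (?y \<^bold>+\<^bsub>?V\<^esub> ?z)])
           \<in> cube_graph \<E> P1 P2 ?V ?x ?y ?z \<longleftrightarrow> cube_eq ?V ?x ?y ?z"
      using f x y z V by (intro cube_graph_iff) auto
    then show "(wedge \<E> ?V [t ?V (?x \<^bold>+\<^bsub>?V\<^esub> ?y \<^bold>+\<^bsub>?V\<^esub> ?z), t ?V ?x, t ?V ?y, t ?V ?z],
            wedge \<E> ?V [t ?V (?x \<^bold>+\<^bsub>?V\<^esub> ?y), t ?V (?x \<^bold>+\<^bsub>?V\<^esub> ?z), t ?V (?y \<^bold>+\<^bsub>?V\<^esub> ?z)])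
           \<in> cube_graph \<E> P1 P2 ?V ?x ?y ?z \<longleftrightarrow>
      gres A f (u U (x \<^bold>+\<^bsub>U\<^esub> y \<^bold>+\<^bsub>U\<^esub> z) \<cdot>\<^bsub>U\<^esub> u U x \<cdot>\<^bsub>U\<^esub> u U y \<cdot>\<^bsub>U\<^esub> u U z \<cdot>\<^bsub>U\<^esub> (lam2_at U x y \<cdot>\<^bsub>U\<^esub> lam2_at U x z \<cdot>\<^bsub>U\<^esub> lam2_at U y z))
      = gres A f (u U (x \<^bold>+\<^bsub>U\<^esub> y) \<cdot>\<^bsub>U\<^esub> u U (x \<^bold>+\<^bsub>U\<^esub> z) \<cdot>\<^bsub>U\<^esub> u U (y \<^bold>+\<^bsub>U\<^esub> z) \<cdot>\<^bsub>U\<^esub> lam3_at U x y z)"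
      using f(1) x y z U V unfolding lam cube_eq_def unfolding f(2) [symmetric] by (simp add: natural)
  qed (use U x y z law_pair.lam2_closed [OF law_pair_at] law_pair.lam3_closed [OF law_pair_at] in simp_all)
  show ?thesis
    unfolding alternating_biextension_def biextension_iff
    using t t_Mor sigma cube by (simp add: ball_conj_distrib)
qed

end

section \<open>Structures, quadruples and trivializations\<close>

text \<open>A triple and a quadruple linked by \<open>describes\<close>, with the axioms of neither
  side assumed.\<close>

locale described_structure = trivial_section T A B P1 P2 g h t u
  for T :: "('o, 'm) site_data" and A :: "('o, 'm, 'a) group_sheaf" and B :: "('o, 'm, 'b) group_sheaf"
    and P1 P2 :: "'o \<Rightarrow> ('a \<times> 'b \<times> 'b) \<times> ('a \<times> 'b \<times> 'b) \<Rightarrow> 'a \<times> 'b \<times> 'b"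
    and g h :: "'o \<Rightarrow> 'b \<times> 'b \<times> 'b \<Rightarrow> 'a"
    and t :: "'o \<Rightarrow> 'b \<Rightarrow> 'a \<times> 'b \<times> 'b" and u :: "'o \<Rightarrow> 'b \<Rightarrow> 'a" +
  fixes \<phi> :: "'o \<Rightarrow> 'b \<times> 'b \<Rightarrow> 'a"
  assumes phi_Mor: "\<phi> \<in> Mor T (und B \<times>\<^sub>s und B) (und A)"
    and antisym_eq: "\<lbrakk>U \<in> Ob T; x \<in> B_sec U; y \<in> B_sec U\<rbrakk> \<Longrightarrow>
      antisym \<E> P1 P2 t U x y = wedge \<E> U [(\<phi> U (x, y), x, y), (A_one U, y, x)]"
begin

lemmas phi_closed [simp] = Mor2_closed [OF phi_Mor]

text \<open>Condition (6) with its fraction cleared. It holds in this context because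
  \<open>\<phi>\<close> describes the class \<pi>.\<close>

lemma u_add: "\<lbrakk>U \<in> Ob T; x \<in> B_sec U; y \<in> B_sec U\<rbrakk> \<Longrightarrow>
    u U (x \<^bold>+\<^bsub>U\<^esub> y) = lam2_at U x y \<cdot>\<^bsub>U\<^esub> \<phi> U (x, y) \<cdot>\<^bsub>U\<^esub> (u U x \<cdot>\<^bsub>U\<^esub> u U y)"
  using antisym_iff [OF _ _ _ phi_closed] antisym_eq by blast

lemma lam_eq: "U \<in> Ob T \<Longrightarrow> lam g h U x y = lam2_at U x y"
  by (simp add: lam_def law_pair.lam2_def [OF law_pair_at])

text \<open>Condition (6) is already available as \<open>u_add\<close>, so it does not reappear on
  the right; the other conditions appear with cleared fractions.\<close>

lemma quadruples_iff: "(g, h, \<phi>, u) \<in> quadruples \<longleftrightarrow> (\<forall>U\<in>Ob T. biext_cocycles g h U \<and>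
    (\<forall>x\<in>B_sec U. \<forall>y\<in>B_sec U. \<forall>z\<in>B_sec U.
       \<phi> U (x \<^bold>+\<^bsub>U\<^esub> y, z) = g U (x, y, z) \<cdot>\<^bsub>U\<^esub> h U (z, x, y) \<cdot>\<^bsub>U\<^esub> (\<phi> U (x, z) \<cdot>\<^bsub>U\<^esub> \<phi> U (y, z))) \<and>
    (\<forall>x\<in>B_sec U. \<forall>y\<in>B_sec U. \<forall>y'\<in>B_sec U.
       \<phi> U (x, y \<^bold>+\<^bsub>U\<^esub> y') = h U (x, y, y') \<cdot>\<^bsub>U\<^esub> g U (y, y', x) \<cdot>\<^bsub>U\<^esub> (\<phi> U (x, y) \<cdot>\<^bsub>U\<^esub> \<phi> U (x, y'))) \<and>
    (\<forall>x\<in>B_sec U. \<forall>y\<in>B_sec U. \<phi> U (x, y) = \<phi> U (y, x)) \<and>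
    (\<forall>x\<in>B_sec U. u U x \<cdot>\<^bsub>U\<^esub> u U x = \<phi> U (x, x)))"
proof -
  have fraction_eq_iff: "a \<^bold>/\<^bsub>U\<^esub> (b \<cdot>\<^bsub>U\<^esub> b') = c \<^bold>/\<^bsub>U\<^esub> (d \<cdot>\<^bsub>U\<^esub> d') \<longleftrightarrow> a \<cdot>\<^bsub>U\<^esub> (d \<cdot>\<^bsub>U\<^esub> d') = c \<cdot>\<^bsub>U\<^esub> (b \<cdot>\<^bsub>U\<^esub> b')"
    if U: "U \<in> Ob T" and a: "a \<in> A_sec U" "b \<in> A_sec U" "b' \<in> A_sec U" "c \<in> A_sec U" "d \<in> A_sec U" "d' \<in> A_sec U"
    for U a b b' c d d'
  proof -
    interpret comm_group "grp A U" by (rule A_comm_group [OF U])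
    have "a \<^bold>/\<^bsub>U\<^esub> (b \<cdot>\<^bsub>U\<^esub> b') = c \<^bold>/\<^bsub>U\<^esub> (d \<cdot>\<^bsub>U\<^esub> d') \<longleftrightarrow> c \<^bold>/\<^bsub>U\<^esub> (d \<cdot>\<^bsub>U\<^esub> d') \<cdot>\<^bsub>U\<^esub> (b \<cdot>\<^bsub>U\<^esub> b') = a"
      using U a by (subst div_eq_iff) auto
    also have "c \<^bold>/\<^bsub>U\<^esub> (d \<cdot>\<^bsub>U\<^esub> d') \<cdot>\<^bsub>U\<^esub> (b \<cdot>\<^bsub>U\<^esub> b') = (c \<cdot>\<^bsub>U\<^esub> (b \<cdot>\<^bsub>U\<^esub> b')) \<^bold>/\<^bsub>U\<^esub> (d \<cdot>\<^bsub>U\<^esub> d')"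
      using U a by (simp add: m_ac)
    also have "\<dots> = a \<longleftrightarrow> a \<cdot>\<^bsub>U\<^esub> (d \<cdot>\<^bsub>U\<^esub> d') = c \<cdot>\<^bsub>U\<^esub> (b \<cdot>\<^bsub>U\<^esub> b')"
      using U a by (subst div_eq_iff) auto
    finally show ?thesis .
  qed
  have div: "a \<^bold>/\<^bsub>U\<^esub> b = c \<longleftrightarrow> a = c \<cdot>\<^bsub>U\<^esub> b"
    if "U \<in> Ob T" "a \<in> A_sec U" "b \<in> A_sec U" "c \<in> A_sec U" for U a b c
    using comm_group.div_eq_iff [OF A_comm_group] that by metis
  have lam_phi: "lam g h U x y \<cdot>\<^bsub>U\<^esub> \<phi> U (x, y) = u U (x \<^bold>+\<^bsub>U\<^esub> y) \<^bold>/\<^bsub>U\<^esub> (u U x \<cdot>\<^bsub>U\<^esub> u U y)"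
    if "U \<in> Ob T" "x \<in> B_sec U" "y \<in> B_sec U" for U x y
    using div [of U "u U (x \<^bold>+\<^bsub>U\<^esub> y)" "u U x \<cdot>\<^bsub>U\<^esub> u U y" "lam g h U x y \<cdot>\<^bsub>U\<^esub> \<phi> U (x, y)"] that
    by (simp add: lam_eq u_add law_pair.lam2_closed [OF law_pair_at])
  show ?thesis
    unfolding quadruples_def biext_cocycles_def
    using g_Mor h_Mor phi_Mor u_Mor
    by (simp add: fraction_eq_iff lam_phi) (simp add: div ball_conj_distrib)
qed

lemma alternating_iff_quadruple:
  "(P1, P2, t) \<in> alternating_structures \<E> \<longleftrightarrow> (g, h, \<phi>, u) \<in> quadruples"
proof -
  have "(P1, P2, t) \<in> alternating_structures \<E> \<longleftrightarrow> alternating_biextension \<E> P1 P2 t"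
    by (simp add: alternating_structures_def)
  also have "\<dots> \<longleftrightarrow> (g, h, \<phi>, u) \<in> quadruples"
    unfolding alternating_biextension_iff quadruples_iff
  \<comment> \<open>The congruence rule makes (1) to (3) available while the remaining conditions
    are compared.\<close>
  proof (intro ball_cong refl, rule conj_cong [OF refl])
    fix U assume U: "U \<in> Ob T" and cocycles: "biext_cocycles g h U"
    interpret alternating_pair "grp A U" "grp B U" "g U" "h U" "\<phi> U" "u U"
      using law_pair_at [OF U] cocycles U u_add [OF U]
      by (simp add: alternating_pair_def alternating_pair_axioms_def biext_cocycles_def)
    have cube: "cube_eq U x y z \<longleftrightarrow>
        \<phi> U (x \<^bold>+\<^bsub>U\<^esub> y, z) = g U (x, y, z) \<cdot>\<^bsub>U\<^esub> h U (z, x, y) \<cdot>\<^bsub>U\<^esub> (\<phi> U (x, z) \<cdot>\<^bsub>U\<^esub> \<phi> U (y, z))"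
      if "x \<in> B_sec U" "y \<in> B_sec U" "z \<in> B_sec U" for x y z
      unfolding cube_eq_def using that by (rule cube_iff_phi_add)
    \<comment> \<open>The cube condition at (y, y', x), with the symmetry of \<open>\<phi>\<close>
      moving x to the first slot, is the second half of (4).\<close>
    have phi_add: "(\<forall>x\<in>B_sec U. \<forall>y\<in>B_sec U. \<forall>z\<in>B_sec U. cube_eq U x y z) \<longleftrightarrow>
        (\<forall>x\<in>B_sec U. \<forall>y\<in>B_sec U. \<forall>y'\<in>B_sec U.
          \<phi> U (x, y \<^bold>+\<^bsub>U\<^esub> y') = h U (x, y, y') \<cdot>\<^bsub>U\<^esub> g U (y, y', x) \<cdot>\<^bsub>U\<^esub> (\<phi> U (x, y) \<cdot>\<^bsub>U\<^esub> \<phi> U (x, y')))"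
    proof -
      have "cube_eq U y y' x \<longleftrightarrow>
          \<phi> U (x, y \<^bold>+\<^bsub>U\<^esub> y') = h U (x, y, y') \<cdot>\<^bsub>U\<^esub> g U (y, y', x) \<cdot>\<^bsub>U\<^esub> (\<phi> U (x, y) \<cdot>\<^bsub>U\<^esub> \<phi> U (x, y'))"
        if "x \<in> B_sec U" "y \<in> B_sec U" "y' \<in> B_sec U" for x y y'
        using that U by (simp add: cube phi_commute [of _ x] A.m_comm [of "g U (y, y', x)"])
      then show ?thesis by blast
    qed
    \<comment> \<open>This equivalence needs additivity of \<open>\<phi>\<close>, hence the cube
      condition as a premise; the symmetry condition and (7) are compared only in its
      presence.\<close>
    have sigma: "sigma_eq U x \<longleftrightarrow> u U x \<cdot>\<^bsub>U\<^esub> u U x = \<phi> U (x, x)"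
      if "x \<in> B_sec U" "\<forall>x\<in>B_sec U. \<forall>y\<in>B_sec U. \<forall>z\<in>B_sec U. cube_eq U x y z" for x
      unfolding sigma_eq_def using that phi_add by (intro sigma_iff_phi_diagonal) simp_all
    show "((\<forall>x\<in>B_sec U. sigma_eq U x) \<and> (\<forall>x\<in>B_sec U. \<forall>y\<in>B_sec U. \<forall>z\<in>B_sec U. cube_eq U x y z)) \<longleftrightarrow>
      ((\<forall>x\<in>B_sec U. \<forall>y\<in>B_sec U. \<forall>z\<in>B_sec U.
         \<phi> U (x \<^bold>+\<^bsub>U\<^esub> y, z) = g U (x, y, z) \<cdot>\<^bsub>U\<^esub> h U (z, x, y) \<cdot>\<^bsub>U\<^esub> (\<phi> U (x, z) \<cdot>\<^bsub>U\<^esub> \<phi> U (y, z))) \<and>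
      (\<forall>x\<in>B_sec U. \<forall>y\<in>B_sec U. \<forall>y'\<in>B_sec U.
         \<phi> U (x, y \<^bold>+\<^bsub>U\<^esub> y') = h U (x, y, y') \<cdot>\<^bsub>U\<^esub> g U (y, y', x) \<cdot>\<^bsub>U\<^esub> (\<phi> U (x, y) \<cdot>\<^bsub>U\<^esub> \<phi> U (x, y'))) \<and>
      (\<forall>x\<in>B_sec U. \<forall>y\<in>B_sec U. \<phi> U (x, y) = \<phi> U (y, x)) \<and>
      (\<forall>x\<in>B_sec U. u U x \<cdot>\<^bsub>U\<^esub> u U x = \<phi> U (x, x)))"
      using cube phi_add sigma phi_commute by meson
  qed
  finally show ?thesis .
qed

text \<open>The equation k(x, y) k(y, x) = \<phi>(x, y) has no counterpart in the definition of a
  trivialization and must be derived. Decomposing s(x + y, x + y) by both laws gives t(x + y) as the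
  fourfold sum of t(x), s(x, y), s(y, x), t(y), so s(x, y) and s(y, x) together represent \<pi>(x,
  y).\<close>

lemma trivialization_iff_trivializing_map:
  assumes q: "(g, h, \<phi>, u) \<in> quadruples"
    and s: "s \<in> Mor T (und B \<times>\<^sub>s und B) (Tot \<E>)" and k: "k \<in> Mor T (und B \<times>\<^sub>s und B) (und A)"
    and sk: "section_describes s k"
  shows "s \<in> trivializations \<E> (P1, P2, t) \<longleftrightarrow> k \<in> trivializing_maps (g, h, \<phi>, u)"
proof -
  note k_closed [simp] = Mor2_closed [OF k]
  have s_apply [simp]: "s U (x, y) = (k U (x, y), x, y)" if "U \<in> Ob T" "x \<in> B_sec U" "y \<in> B_sec U" for U x y
    using sk that by (simp add: section_describes_def)
  have div: "c = a \<^bold>/\<^bsub>U\<^esub> b \<longleftrightarrow> a = b \<cdot>\<^bsub>U\<^esub> c" if "U \<in> Ob T" "a \<in> A_sec U" "b \<in> A_sec U" "c \<in> A_sec U" for U a b c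
    using comm_group.div_eq_iff [OF A_comm_group, of U a b c]
      comm_monoid.m_comm [OF comm_group.axioms(1) [OF A_comm_group], of U b c] that by auto
  have *: "s \<in> trivializations \<E> (P1, P2, t) \<longleftrightarrow>
      (\<forall>U\<in>Ob T. \<forall>x\<in>B_sec U. \<forall>x'\<in>B_sec U. \<forall>y\<in>B_sec U.
        g U (x, x', y) = k U (x \<^bold>+\<^bsub>U\<^esub> x', y) \<^bold>/\<^bsub>U\<^esub> (k U (x, y) \<cdot>\<^bsub>U\<^esub> k U (x', y))) \<and>
      (\<forall>U\<in>Ob T. \<forall>x\<in>B_sec U. \<forall>y\<in>B_sec U. \<forall>y'\<in>B_sec U.
        h U (x, y, y') = k U (x, y \<^bold>+\<^bsub>U\<^esub> y') \<^bold>/\<^bsub>U\<^esub> (k U (x, y) \<cdot>\<^bsub>U\<^esub> k U (x, y'))) \<and>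
      (\<forall>U\<in>Ob T. \<forall>x\<in>B_sec U. k U (x, x) = u U x)"
    using s by (simp add: trivialization_def fib_trivial div)
  have "k U (x, y) \<cdot>\<^bsub>U\<^esub> k U (y, x) = \<phi> U (x, y)"
    if "s \<in> trivializations \<E> (P1, P2, t)" and U: "U \<in> Ob T" and x: "x \<in> B_sec U" and y: "y \<in> B_sec U" for U x y
  proof -
    interpret law_pair "grp A U" "grp B U" "g U" "h U" by (rule law_pair_at [OF U])
    note [simp] = U x y
    have s1: "s U (b \<^bold>+\<^bsub>U\<^esub> b', c) = P1 U (s U (b, c), s U (b', c))"
      and s2: "s U (b, b' \<^bold>+\<^bsub>U\<^esub> c) = P2 U (s U (b, b'), s U (b, c))"
      and s_diag: "t U b = s U (b, b)"
      if "b \<in> B_sec U" "b' \<in> B_sec U" "c \<in> B_sec U" for b b' c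
      using \<open>s \<in> trivializations \<E> (P1, P2, t)\<close> that by (simp_all add: trivialization_def del: s_apply)
    have "t U (x \<^bold>+\<^bsub>U\<^esub> y) = s U (x \<^bold>+\<^bsub>U\<^esub> y, x \<^bold>+\<^bsub>U\<^esub> y)"
      by (rule s_diag [OF _ x x]) simp
    also have "\<dots> = P1 U (s U (x, x \<^bold>+\<^bsub>U\<^esub> y), s U (y, x \<^bold>+\<^bsub>U\<^esub> y))"
      by (rule s1) simp_all
    also have "\<dots> = sum4 P1 P2 U (s U (x, x)) (s U (x, y)) (s U (y, x)) (s U (y, y))"
      unfolding sum4_def s2 [OF x x y] s2 [OF y x y] ..
    also have "\<dots> = sum4 P1 P2 U (u U x, x, x) (k U (x, y), x, y) (k U (y, x), y, x) (u U y, y, y)"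
      using that(1) unfolding * by simp
    finally have "[(k U (x, y), x, y), (k U (y, x), y, x)] \<in> antisym \<E> P1 P2 t U x y"
      by (auto simp: antisym_def fib_trivial)
    then show ?thesis by (simp add: antisym_eq mem_wedge_trivial)
  qed
  then show ?thesis
    using * k by auto
qed

end

section \<open>Existence and uniqueness of the corresponding data\<close>

context topos_groups
begin

lemma Mor_law1_unique:
  assumes "P \<in> Mor T (dom_law1 \<E>) (Tot \<E>)" "P' \<in> Mor T (dom_law1 \<E>) (Tot \<E>)" "law1 P g" "law1 P' g"
  shows "P = P'"
  using assms(1,2) by (rule Mor_eqI) (use assms(3,4) in \<open>auto simp: law1_def\<close>)

lemma Mor_law2_unique:
  assumes "P \<in> Mor T (dom_law2 \<E>) (Tot \<E>)" "P' \<in> Mor T (dom_law2 \<E>) (Tot \<E>)" "law2 P h" "law2 P' h"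
  shows "P = P'"
  using assms(1,2) by (rule Mor_eqI) (use assms(3,4) in \<open>auto simp: law2_def\<close>)

text \<open>The cocycle is read off from the law at two base points.\<close>

lemma law1_cocycle_unique:
  assumes "g \<in> Mor T (und B \<times>\<^sub>s und B \<times>\<^sub>s und B) (und A)" "g' \<in> Mor T (und B \<times>\<^sub>s und B \<times>\<^sub>s und B) (und A)"
    and "law1 P g" "law1 P g'"
  shows "g = g'"
proof (rule Mor_eqI [OF assms(1,2)])
  fix U b assume U: "U \<in> Ob T" and b: "b \<in> sec (und B \<times>\<^sub>s und B \<times>\<^sub>s und B) U"
  obtain x y z where [simp]: "b = (x, y, z)" "x \<in> B_sec U" "y \<in> B_sec U" "z \<in> B_sec U" using b by auto
  have "P U ((A_one U, x, z), (A_one U, y, z)) = (g U b, x \<^bold>+\<^bsub>U\<^esub> y, z)"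
    using assms(1,3) U by (simp add: law1_def Mor3_closed)
  moreover have "P U ((A_one U, x, z), (A_one U, y, z)) = (g' U b, x \<^bold>+\<^bsub>U\<^esub> y, z)"
    using assms(2,4) U by (simp add: law1_def Mor3_closed)
  ultimately show "g U b = g' U b" by simp
qed

lemma law2_cocycle_unique:
  assumes "h \<in> Mor T (und B \<times>\<^sub>s und B \<times>\<^sub>s und B) (und A)" "h' \<in> Mor T (und B \<times>\<^sub>s und B \<times>\<^sub>s und B) (und A)"
    and "law2 P h" "law2 P h'"
  shows "h = h'"
proof (rule Mor_eqI [OF assms(1,2)])
  fix U b assume U: "U \<in> Ob T" and b: "b \<in> sec (und B \<times>\<^sub>s und B \<times>\<^sub>s und B) U"
  obtain x y z where [simp]: "b = (x, y, z)" "x \<in> B_sec U" "y \<in> B_sec U" "z \<in> B_sec U" using b by auto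
  have "P U ((A_one U, x, y), (A_one U, x, z)) = (h U b, x, y \<^bold>+\<^bsub>U\<^esub> z)"
    using assms(1,3) U by (simp add: law2_def Mor3_closed)
  moreover have "P U ((A_one U, x, y), (A_one U, x, z)) = (h' U b, x, y \<^bold>+\<^bsub>U\<^esub> z)"
    using assms(2,4) U by (simp add: law2_def Mor3_closed)
  ultimately show "h U b = h' U b" by simp
qed

lemma law1_of_cocycle:
  assumes g: "g \<in> Mor T (und B \<times>\<^sub>s und B \<times>\<^sub>s und B) (und A)"
  shows "\<exists>P\<in>Mor T (dom_law1 \<E>) (Tot \<E>). law1 P g"
proof (rule bexI)
  let ?P = "mor T (dom_law1 \<E>) (\<lambda>U ((a, x, y), (a', x', _)). (a \<cdot>\<^bsub>U\<^esub> a' \<cdot>\<^bsub>U\<^esub> g U (x, x', y), x \<^bold>+\<^bsub>U\<^esub> x', y))"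
  show "?P \<in> Mor T (dom_law1 \<E>) (Tot \<E>)"
    by (rule mor_in_Mor) (auto simp: src_Ob tgt_Ob Mor3_closed [OF g] Mor3_natural [OF g])
  show "law1 ?P g" by (simp add: law1_def)
qed

lemma law2_of_cocycle:
  assumes h: "h \<in> Mor T (und B \<times>\<^sub>s und B \<times>\<^sub>s und B) (und A)"
  shows "\<exists>P\<in>Mor T (dom_law2 \<E>) (Tot \<E>). law2 P h"
proof (rule bexI)
  let ?P = "mor T (dom_law2 \<E>) (\<lambda>U ((a, x, y), (a', _, y')). (a \<cdot>\<^bsub>U\<^esub> a' \<cdot>\<^bsub>U\<^esub> h U (x, y, y'), x, y \<^bold>+\<^bsub>U\<^esub> y'))"
  show "?P \<in> Mor T (dom_law2 \<E>) (Tot \<E>)"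
    by (rule mor_in_Mor) (auto simp: src_Ob tgt_Ob Mor3_closed [OF h] Mor3_natural [OF h])
  show "law2 ?P h" by (simp add: law2_def)
qed

lemma biextension_law1D:
  assumes "biextension E P1 P2" "U \<in> Ob T" "x \<in> B_sec U" "x' \<in> B_sec U" "y \<in> B_sec U"
    "e \<in> fib E U x y" "e' \<in> fib E U x' y"
  shows "P1 U (e, e') \<in> fib E U (x \<^bold>+\<^bsub>U\<^esub> x') y"
    and "\<lbrakk>a \<in> A_sec U; a' \<in> A_sec U\<rbrakk> \<Longrightarrow>
      P1 U (act E U (a, e), act E U (a', e')) = act E U (a \<cdot>\<^bsub>U\<^esub> a', P1 U (e, e'))"
proof -
  note * = assms(1) [unfolded biextension_def, THEN conjunct2, THEN conjunct2, THEN conjunct2, THEN conjunct1,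
    rule_format, OF assms(2-7)]
  show "P1 U (e, e') \<in> fib E U (x \<^bold>+\<^bsub>U\<^esub> x') y" by (rule * [THEN conjunct1])
  show "P1 U (act E U (a, e), act E U (a', e')) = act E U (a \<cdot>\<^bsub>U\<^esub> a', P1 U (e, e'))"
    if "a \<in> A_sec U" "a' \<in> A_sec U" using * that by blast
qed

lemma biextension_law2D:
  assumes "biextension E P1 P2" "U \<in> Ob T" "x \<in> B_sec U" "y \<in> B_sec U" "y' \<in> B_sec U"
    "e \<in> fib E U x y" "e' \<in> fib E U x y'"
  shows "P2 U (e, e') \<in> fib E U x (y \<^bold>+\<^bsub>U\<^esub> y')"
    and "\<lbrakk>a \<in> A_sec U; a' \<in> A_sec U\<rbrakk> \<Longrightarrow>
      P2 U (act E U (a, e), act E U (a', e')) = act E U (a \<cdot>\<^bsub>U\<^esub> a', P2 U (e, e'))"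
proof -
  note * = assms(1) [unfolded biextension_def, THEN conjunct2, THEN conjunct2, THEN conjunct2, THEN conjunct2,
    THEN conjunct1, rule_format, OF assms(2-7)]
  show "P2 U (e, e') \<in> fib E U x (y \<^bold>+\<^bsub>U\<^esub> y')" by (rule * [THEN conjunct1])
  show "P2 U (act E U (a, e), act E U (a', e')) = act E U (a \<cdot>\<^bsub>U\<^esub> a', P2 U (e, e'))"
    if "a \<in> A_sec U" "a' \<in> A_sec U" using * that by blast
qed

text \<open>Every element of the trivial torsor is a translate of a base point, so equivariance
  extends the formula from base points to all elements.\<close>

lemma cocycle_of_law1:
  assumes "biextension \<E> P1 P2"
  shows "\<exists>g\<in>Mor T (und B \<times>\<^sub>s und B \<times>\<^sub>s und B) (und A). law1 P1 g"
proof (rule bexI)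
  have P_Mor: "P1 \<in> Mor T (dom_law1 \<E>) (Tot \<E>)" using assms by (simp add: biextension_def)
  let ?g = "mor T (und B \<times>\<^sub>s und B \<times>\<^sub>s und B) (\<lambda>U (x, x', y). fst (P1 U ((A_one U, x, y), (A_one U, x', y))))"
  have P: "P1 U ((A_one U, x, y), (A_one U, x', y)) = (?g U (x, x', y), x \<^bold>+\<^bsub>U\<^esub> x', y)"
    and g_closed: "?g U (x, x', y) \<in> A_sec U"
    if "U \<in> Ob T" "x \<in> B_sec U" "x' \<in> B_sec U" "y \<in> B_sec U" for U x x' y
    using biextension_law1D(1) [OF assms that, of "(A_one U, x, y)" "(A_one U, x', y)"] that
    by (auto simp: fib_trivial image_iff)
  show "?g \<in> Mor T (und B \<times>\<^sub>s und B \<times>\<^sub>s und B) (und A)"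
  proof (rule mor_in_Mor)
    fix f b assume f: "f \<in> Ar T" and b: "b \<in> sec (und B \<times>\<^sub>s und B \<times>\<^sub>s und B) (tgt T f)"
    obtain x x' y where [simp]: "b = (x, x', y)" "x \<in> B_sec (tgt T f)" "x' \<in> B_sec (tgt T f)" "y \<in> B_sec (tgt T f)"
      using b by auto
    show "(\<lambda>(x, x', y). fst (P1 (src T f) ((A_one (src T f), x, y), (A_one (src T f), x', y))))
        (res (und B \<times>\<^sub>s und B \<times>\<^sub>s und B) f b)
      = res (und A) f ((\<lambda>(x, x', y). fst (P1 (tgt T f) ((A_one (tgt T f), x, y), (A_one (tgt T f), x', y)))) b)"
      using Mor_natural [OF P_Mor f, of "((A_one (tgt T f), x, y), (A_one (tgt T f), x', y))"] f
      by (simp add: tgt_Ob)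
  qed (use g_closed in auto)
  show "law1 P1 ?g"
    unfolding law1_def
  proof (intro ballI)
    fix U a a' x x' y
    assume U: "U \<in> Ob T" and a: "a \<in> A_sec U" "a' \<in> A_sec U" and b: "x \<in> B_sec U" "x' \<in> B_sec U" "y \<in> B_sec U"
    interpret A: comm_group "grp A U" by (rule A_comm_group [OF U])
    show "P1 U ((a, x, y), (a', x', y)) = (a \<cdot>\<^bsub>U\<^esub> a' \<cdot>\<^bsub>U\<^esub> ?g U (x, x', y), x \<^bold>+\<^bsub>U\<^esub> x', y)"
      using biextension_law1D(2) [OF assms U b, of "(A_one U, x, y)" "(A_one U, x', y)" a a'] U a b g_closed [OF U b]
      by (simp add: P fib_trivial image_iff del: mor_apply)
  qed
qed

lemma cocycle_of_law2:
  assumes "biextension \<E> P1 P2"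
  shows "\<exists>h\<in>Mor T (und B \<times>\<^sub>s und B \<times>\<^sub>s und B) (und A). law2 P2 h"
proof (rule bexI)
  have P_Mor: "P2 \<in> Mor T (dom_law2 \<E>) (Tot \<E>)" using assms by (simp add: biextension_def)
  let ?h = "mor T (und B \<times>\<^sub>s und B \<times>\<^sub>s und B) (\<lambda>U (x, y, y'). fst (P2 U ((A_one U, x, y), (A_one U, x, y'))))"
  have P: "P2 U ((A_one U, x, y), (A_one U, x, y')) = (?h U (x, y, y'), x, y \<^bold>+\<^bsub>U\<^esub> y')"
    and h_closed: "?h U (x, y, y') \<in> A_sec U"
    if "U \<in> Ob T" "x \<in> B_sec U" "y \<in> B_sec U" "y' \<in> B_sec U" for U x y y'
    using biextension_law2D(1) [OF assms that, of "(A_one U, x, y)" "(A_one U, x, y')"] that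
    by (auto simp: fib_trivial image_iff)
  show "?h \<in> Mor T (und B \<times>\<^sub>s und B \<times>\<^sub>s und B) (und A)"
  proof (rule mor_in_Mor)
    fix f b assume f: "f \<in> Ar T" and b: "b \<in> sec (und B \<times>\<^sub>s und B \<times>\<^sub>s und B) (tgt T f)"
    obtain x y y' where [simp]: "b = (x, y, y')" "x \<in> B_sec (tgt T f)" "y \<in> B_sec (tgt T f)" "y' \<in> B_sec (tgt T f)"
      using b by auto
    show "(\<lambda>(x, y, y'). fst (P2 (src T f) ((A_one (src T f), x, y), (A_one (src T f), x, y'))))
        (res (und B \<times>\<^sub>s und B \<times>\<^sub>s und B) f b)
      = res (und A) f ((\<lambda>(x, y, y'). fst (P2 (tgt T f) ((A_one (tgt T f), x, y), (A_one (tgt T f), x, y')))) b)"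
      using Mor_natural [OF P_Mor f, of "((A_one (tgt T f), x, y), (A_one (tgt T f), x, y'))"] f
      by (simp add: tgt_Ob)
  qed (use h_closed in auto)
  show "law2 P2 ?h"
    unfolding law2_def
  proof (intro ballI)
    fix U a a' x y y'
    assume U: "U \<in> Ob T" and a: "a \<in> A_sec U" "a' \<in> A_sec U" and b: "x \<in> B_sec U" "y \<in> B_sec U" "y' \<in> B_sec U"
    interpret A: comm_group "grp A U" by (rule A_comm_group [OF U])
    show "P2 U ((a, x, y), (a', x, y')) = (a \<cdot>\<^bsub>U\<^esub> a' \<cdot>\<^bsub>U\<^esub> ?h U (x, y, y'), x, y \<^bold>+\<^bsub>U\<^esub> y')"
      using biextension_law2D(2) [OF assms U b, of "(A_one U, x, y)" "(A_one U, x, y')" a a'] U a b h_closed [OF U b]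
      by (simp add: P fib_trivial image_iff del: mor_apply)
  qed
qed

lemma described_structureI:
  assumes "P1 \<in> Mor T (dom_law1 \<E>) (Tot \<E>)" "P2 \<in> Mor T (dom_law2 \<E>) (Tot \<E>)" "t \<in> Mor T (und B) (Tot \<E>)"
    and "g \<in> Mor T (und B \<times>\<^sub>s und B \<times>\<^sub>s und B) (und A)" "h \<in> Mor T (und B \<times>\<^sub>s und B \<times>\<^sub>s und B) (und A)"
    and "\<phi> \<in> Mor T (und B \<times>\<^sub>s und B) (und A)" "u \<in> Mor T (und B) (und A)"
    and "describes (P1, P2, t) (g, h, \<phi>, u)"
  shows "described_structure T A B P1 P2 g h t u \<phi>"
  using assms topos_groups_axioms
  by (auto simp: described_structure_def described_structure_axioms_def trivial_section_def
      trivial_section_axioms_def trivial_laws_def trivial_laws_axioms_def law1_def law2_def)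

lemma describes_iff:
  "describes (P1, P2, t) (g, h, \<phi>, u) \<longleftrightarrow> law1 P1 g \<and> law2 P2 h \<and>
     (\<forall>U\<in>Ob T. \<forall>x\<in>B_sec U. \<forall>y\<in>B_sec U.
        antisym \<E> P1 P2 t U x y = wedge \<E> U [(\<phi> U (x, y), x, y), (A_one U, y, x)]) \<and>
     (\<forall>U\<in>Ob T. \<forall>x\<in>B_sec U. t U x = (u U x, x, x))"
  by (simp add: law1_def law2_def)

lemma alternating_structures_Mor:
  assumes "(P1, P2, t) \<in> alternating_structures \<E>"
  shows "P1 \<in> Mor T (dom_law1 \<E>) (Tot \<E>)" "P2 \<in> Mor T (dom_law2 \<E>) (Tot \<E>)" "t \<in> Mor T (und B) (Tot \<E>)"
  using assms by (simp_all add: alternating_structures_def alternating_biextension_def biextension_def)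

lemma quadruples_Mor:
  assumes "(g, h, \<phi>, u) \<in> quadruples"
  shows "g \<in> Mor T (und B \<times>\<^sub>s und B \<times>\<^sub>s und B) (und A)" "h \<in> Mor T (und B \<times>\<^sub>s und B \<times>\<^sub>s und B) (und A)"
    "\<phi> \<in> Mor T (und B \<times>\<^sub>s und B) (und A)" "u \<in> Mor T (und B) (und A)"
  using assms by (simp_all add: quadruples_def)

lemma ex_quadruple:
  assumes "E \<in> alternating_structures \<E>"
  shows "\<exists>q\<in>quadruples. describes E q"
proof -
  obtain P1 P2 t where E: "E = (P1, P2, t)" by (cases E)
  have alt: "alternating_biextension \<E> P1 P2 t" and "biextension \<E> P1 P2"
    using assms by (simp_all add: E alternating_structures_def alternating_biextension_def)
  note Mors = alternating_structures_Mor [OF assms [unfolded E]]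
  obtain g where g: "g \<in> Mor T (und B \<times>\<^sub>s und B \<times>\<^sub>s und B) (und A)" "law1 P1 g"
    using cocycle_of_law1 [OF \<open>biextension \<E> P1 P2\<close>] by blast
  obtain h where h: "h \<in> Mor T (und B \<times>\<^sub>s und B \<times>\<^sub>s und B) (und A)" "law2 P2 h"
    using cocycle_of_law2 [OF \<open>biextension \<E> P1 P2\<close>] by blast
  define u where "u = mor T (und B) (\<lambda>U x. fst (t U x))"
  have t: "t U x = (u U x, x, x)" "u U x \<in> A_sec U" if "U \<in> Ob T" "x \<in> B_sec U" for U x
  proof -
    have "t U x \<in> fib \<E> U x x" using alt that by (simp add: alternating_biextension_def)
    then show "t U x = (u U x, x, x)" "u U x \<in> A_sec U" using that by (auto simp: u_def fib_trivial)
  qed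
  have u: "u \<in> Mor T (und B) (und A)"
    unfolding u_def
  proof (rule mor_in_Mor)
    fix f x assume "f \<in> Ar T" "x \<in> sec (und B) (tgt T f)"
    then show "fst (t (src T f) (res (und B) f x)) = res (und A) f (fst (t (tgt T f) x))"
      using Mor_natural [OF Mors(3), of f x] by simp
  qed (use t in auto)
  interpret trivial_section T A B P1 P2 g h t u
    by unfold_locales (use g h Mors u t in auto)
  \<comment> \<open>\<open>antisym_iff\<close> leaves no choice: this is (6) solved for
    \<open>\<phi>\<close>.\<close>
  define \<phi> where "\<phi> = mor T (und B \<times>\<^sub>s und B) (\<lambda>U (x, y). u U (x \<^bold>+\<^bsub>U\<^esub> y) \<^bold>/\<^bsub>U\<^esub> (lam2_at U x y \<cdot>\<^bsub>U\<^esub> (u U x \<cdot>\<^bsub>U\<^esub> u U y)))"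
  have phi: "\<phi> \<in> Mor T (und B \<times>\<^sub>s und B) (und A)"
    unfolding \<phi>_def
    by (rule mor_in_Mor)
      (auto simp: src_Ob tgt_Ob law_pair.lam2_def [OF law_pair_at]
        Mor1_natural [OF u] Mor3_natural [OF g(1)] Mor3_natural [OF h(1)])
  have "antisym \<E> P1 P2 t U x y = wedge \<E> U [(\<phi> U (x, y), x, y), (A_one U, y, x)]"
    if U: "U \<in> Ob T" and x: "x \<in> B_sec U" and y: "y \<in> B_sec U" for U x y
  proof -
    interpret law_pair "grp A U" "grp B U" "g U" "h U" by (rule law_pair_at [OF U])
    have "u U (x \<^bold>+\<^bsub>U\<^esub> y) = \<phi> U (x, y) \<cdot>\<^bsub>U\<^esub> (lam2_at U x y \<cdot>\<^bsub>U\<^esub> (u U x \<cdot>\<^bsub>U\<^esub> u U y))"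
      using U x y by (simp add: \<phi>_def A.m_assoc)
    also have "\<dots> = lam2_at U x y \<cdot>\<^bsub>U\<^esub> \<phi> U (x, y) \<cdot>\<^bsub>U\<^esub> (u U x \<cdot>\<^bsub>U\<^esub> u U y)"
      using U x y Mor2_closed [OF phi U x y] by (simp add: A.m_ac)
    finally show ?thesis using antisym_iff [OF U x y Mor2_closed [OF phi U x y]] by blast
  qed
  then have desc: "describes (P1, P2, t) (g, h, \<phi>, u)"
    unfolding describes_iff using g h t by simp
  have "(g, h, \<phi>, u) \<in> quadruples"
    using described_structure.alternating_iff_quadruple [OF described_structureI [OF Mors g(1) h(1) phi u desc]]
      assms E by simp
  with desc show ?thesis unfolding E by blast
qed

lemma ex_structure:
  assumes "q \<in> quadruples"
  shows "\<exists>E\<in>alternating_structures \<E>. describes E q"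
proof -
  obtain g h \<phi> u where q: "q = (g, h, \<phi>, u)" by (cases q)
  note Mors = quadruples_Mor [OF assms [unfolded q]]
  obtain P1 where P1: "P1 \<in> Mor T (dom_law1 \<E>) (Tot \<E>)" "law1 P1 g"
    using law1_of_cocycle [OF Mors(1)] by blast
  obtain P2 where P2: "P2 \<in> Mor T (dom_law2 \<E>) (Tot \<E>)" "law2 P2 h"
    using law2_of_cocycle [OF Mors(2)] by blast
  define t where "t = mor T (und B) (\<lambda>U x. (u U x, x, x))"
  have t: "t \<in> Mor T (und B) (Tot \<E>)"
    unfolding t_def by (rule mor_in_Mor) (auto simp: Mor1_closed [OF Mors(4)] Mor1_natural [OF Mors(4)])
  interpret trivial_section T A B P1 P2 g h t u
    by unfold_locales (use P1 P2 Mors t in \<open>auto simp: t_def\<close>)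
  have "antisym \<E> P1 P2 t U x y = wedge \<E> U [(\<phi> U (x, y), x, y), (A_one U, y, x)]"
    if U: "U \<in> Ob T" and x: "x \<in> B_sec U" and y: "y \<in> B_sec U" for U x y
  proof -
    interpret law_pair "grp A U" "grp B U" "g U" "h U" by (rule law_pair_at [OF U])
    have p: "\<phi> U (x, y) \<in> A_sec U" using Mor2_closed [OF Mors(3) U x y] .
    \<comment> \<open>Among the conditions on a quadruple, (6) is the one that makes
      \<open>\<phi>\<close> describe the class determined by \<open>t\<close>.\<close>
    have "lam g h U x y \<cdot>\<^bsub>U\<^esub> \<phi> U (x, y) = u U (x \<^bold>+\<^bsub>U\<^esub> y) \<^bold>/\<^bsub>U\<^esub> (u U x \<cdot>\<^bsub>U\<^esub> u U y)"
      using assms U x y unfolding q quadruples_def by simp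
    then have "u U (x \<^bold>+\<^bsub>U\<^esub> y) = lam g h U x y \<cdot>\<^bsub>U\<^esub> \<phi> U (x, y) \<cdot>\<^bsub>U\<^esub> (u U x \<cdot>\<^bsub>U\<^esub> u U y)"
      using U x y p by (simp add: A.m_assoc)
    then show ?thesis
      unfolding antisym_iff [OF U x y p] by (simp add: lam_def lam2_def)
  qed
  then have desc: "describes (P1, P2, t) q"
    unfolding q describes_iff using P1 P2 by (simp add: t_def)
  have "(P1, P2, t) \<in> alternating_structures \<E>"
    using described_structure.alternating_iff_quadruple [OF described_structureI [OF P1(1) P2(1) t Mors desc [unfolded q]]]
      assms q by simp
  with desc show ?thesis by blast
qed

lemma quadruple_unique:
  assumes "q \<in> quadruples" "q' \<in> quadruples" "describes E q" "describes E q'"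
  shows "q = q'"
proof -
  obtain P1 P2 t where E: "E = (P1, P2, t)" by (cases E)
  obtain g h \<phi> u where q: "q = (g, h, \<phi>, u)" by (cases q)
  obtain g' h' \<phi>' u' where q': "q' = (g', h', \<phi>', u')" by (cases q')
  note Mors = quadruples_Mor [OF assms(1) [unfolded q]] and Mors' = quadruples_Mor [OF assms(2) [unfolded q']]
  note d = assms(3) [unfolded E q describes_iff] and d' = assms(4) [unfolded E q' describes_iff]
  have "g = g'" "h = h'"
    using law1_cocycle_unique [OF Mors(1) Mors'(1)] law2_cocycle_unique [OF Mors(2) Mors'(2)] d d' by blast+
  moreover have "\<phi> = \<phi>'"
  proof (rule Mor_eqI [OF Mors(3) Mors'(3)])
    fix U b assume U: "U \<in> Ob T" and b: "b \<in> sec (und B \<times>\<^sub>s und B) U"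
    interpret A: comm_group "grp A U" by (rule A_comm_group [OF U])
    obtain x y where [simp]: "b = (x, y)" "x \<in> B_sec U" "y \<in> B_sec U" using b by auto
    \<comment> \<open>Both maps describe the same class, and the base point is fixed, so the
      coefficients agree.\<close>
    have "wedge \<E> U [(\<phi> U (x, y), x, y), (A_one U, y, x)] = wedge \<E> U [(\<phi>' U (x, y), x, y), (A_one U, y, x)]"
      using d d' U by simp
    then show "\<phi> U b = \<phi>' U b"
      using U by (simp add: wedge_trivial_eq_iff Mor2_closed [OF Mors(3)] Mor2_closed [OF Mors'(3)])
  qed
  moreover have "u = u'"
    by (rule Mor_eqI [OF Mors(4) Mors'(4)]) (use d d' in auto)
  ultimately show ?thesis by (simp add: q q')
qed

lemma structure_unique:
  assumes "E \<in> alternating_structures \<E>" "E' \<in> alternating_structures \<E>" "describes E q" "describes E' q"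
  shows "E = E'"
proof -
  obtain P1 P2 t where E: "E = (P1, P2, t)" by (cases E)
  obtain P1' P2' t' where E': "E' = (P1', P2', t')" by (cases E')
  obtain g h \<phi> u where q: "q = (g, h, \<phi>, u)" by (cases q)
  note Mors = alternating_structures_Mor [OF assms(1) [unfolded E]]
    and Mors' = alternating_structures_Mor [OF assms(2) [unfolded E']]
  note d = assms(3) [unfolded E q describes_iff] and d' = assms(4) [unfolded E' q describes_iff]
  have "P1 = P1'" "P2 = P2'"
    using Mor_law1_unique [OF Mors(1) Mors'(1)] Mor_law2_unique [OF Mors(2) Mors'(2)] d d' by blast+
  moreover have "t = t'"
    by (rule Mor_eqI [OF Mors(3) Mors'(3)]) (use d d' in auto)
  ultimately show ?thesis by (simp add: E E')
qed

text \<open>A section of the trivial torsor over B x B is the graph of its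
  \<open>A\<close>-component. This matches morphisms with morphisms, and
  \<open>trivialization_iff_trivializing_map\<close> then matches the conditions on them.\<close>

lemma trivializations_correspond:
  assumes E: "E \<in> alternating_structures \<E>" and q: "q \<in> quadruples" and desc: "describes E q"
  shows "\<forall>s\<in>trivializations \<E> E. \<exists>!k\<in>trivializing_maps q. section_describes s k"
    and "\<forall>k\<in>trivializing_maps q. \<exists>!s\<in>trivializations \<E> E. section_describes s k"
proof -
  obtain P1 P2 t where E': "E = (P1, P2, t)" by (cases E)
  obtain g h \<phi> u where q': "q = (g, h, \<phi>, u)" by (cases q)
  interpret described_structure T A B P1 P2 g h t u \<phi>
    using alternating_structures_Mor [OF E [unfolded E']] quadruples_Mor [OF q [unfolded q']] desc [unfolded E' q']
    by (rule described_structureI)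
  note iff = trivialization_iff_trivializing_map [OF q [unfolded q'], folded E' q']
  have s_Mor: "s \<in> Mor T (und B \<times>\<^sub>s und B) (Tot \<E>)" if "s \<in> trivializations \<E> E" for s
    using that by (simp add: E' trivialization_def)
  have k_Mor: "k \<in> Mor T (und B \<times>\<^sub>s und B) (und A)" if "k \<in> trivializing_maps q" for k
    using that by (simp add: q')
  show "\<forall>s\<in>trivializations \<E> E. \<exists>!k\<in>trivializing_maps q. section_describes s k"
  proof
    fix s assume s: "s \<in> trivializations \<E> E"
    define k where "k = mor T (und B \<times>\<^sub>s und B) (\<lambda>U p. fst (s U p))"
    have sk: "s U (x, y) = (k U (x, y), x, y)" "k U (x, y) \<in> A_sec U"
      if "U \<in> Ob T" "x \<in> B_sec U" "y \<in> B_sec U" for U x y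
    proof -
      have "s U (x, y) \<in> fib \<E> U x y" using s that by (simp add: E' trivialization_def)
      then show "s U (x, y) = (k U (x, y), x, y)" "k U (x, y) \<in> A_sec U"
        using that by (auto simp: k_def fib_trivial)
    qed
    have k: "k \<in> Mor T (und B \<times>\<^sub>s und B) (und A)"
      unfolding k_def
    proof (rule mor_in_Mor)
      fix f p assume "f \<in> Ar T" "p \<in> sec (und B \<times>\<^sub>s und B) (tgt T f)"
      then show "fst (s (src T f) (res (und B \<times>\<^sub>s und B) f p)) = res (und A) f (fst (s (tgt T f) p))"
        using Mor_natural [OF s_Mor [OF s], of f p] by simp
    qed (use sk in auto)
    have desc_k: "section_describes s k" using sk by (simp add: section_describes_def)
    show "\<exists>!k\<in>trivializing_maps q. section_describes s k"
    proof (rule ex1I [of _ k])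
      show "k \<in> trivializing_maps q \<and> section_describes s k"
        using iff [OF s_Mor [OF s] k desc_k] s desc_k by simp
      show "k' = k" if "k' \<in> trivializing_maps q \<and> section_describes s k'" for k'
        by (rule Mor_eqI [OF k_Mor k]) (use that desc_k in \<open>auto simp: section_describes_def\<close>)
    qed
  qed
  show "\<forall>k\<in>trivializing_maps q. \<exists>!s\<in>trivializations \<E> E. section_describes s k"
  proof
    fix k assume k: "k \<in> trivializing_maps q"
    define s where "s = mor T (und B \<times>\<^sub>s und B) (\<lambda>U p. (k U p, p))"
    have s: "s \<in> Mor T (und B \<times>\<^sub>s und B) (Tot \<E>)"
      unfolding s_def
      by (rule mor_in_Mor) (auto simp: Mor2_closed [OF k_Mor [OF k]] Mor2_natural [OF k_Mor [OF k]])
    have desc_s: "section_describes s k" by (simp add: section_describes_def s_def)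
    show "\<exists>!s\<in>trivializations \<E> E. section_describes s k"
    proof (rule ex1I [of _ s])
      show "s \<in> trivializations \<E> E \<and> section_describes s k"
        using iff [OF s k_Mor [OF k] desc_s] k desc_s by simp
      show "s' = s" if "s' \<in> trivializations \<E> E \<and> section_describes s' k" for s'
        by (rule Mor_eqI [OF s_Mor s]) (use that desc_s in \<open>auto simp: section_describes_def\<close>)
    qed
  qed
qed

end

theorem proposition2p4:
  fixes T :: "('o, 'm) site_data"
    and A :: "('o, 'm, 'a) group_sheaf"
    and B :: "('o, 'm, 'b) group_sheaf"
  assumes "topos_groups T A B"
  shows
    "(\<forall>\<E>\<in>topos_groups.alternating_structures T A B (topos_groups.trivial_torsor T A B).
        \<exists>!q\<in>topos_groups.quadruples T A B. topos_groups.describes T A B \<E> q) \<and>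
     (\<forall>q\<in>topos_groups.quadruples T A B.
        \<exists>!\<E>\<in>topos_groups.alternating_structures T A B (topos_groups.trivial_torsor T A B).
          topos_groups.describes T A B \<E> q) \<and>
     (\<forall>\<E>\<in>topos_groups.alternating_structures T A B (topos_groups.trivial_torsor T A B).
        \<forall>q\<in>topos_groups.quadruples T A B. topos_groups.describes T A B \<E> q \<longrightarrow>
          (\<forall>s\<in>topos_groups.trivializations T B (topos_groups.trivial_torsor T A B) \<E>.
             \<exists>!k\<in>topos_groups.trivializing_maps T A B q. topos_groups.section_describes T B s k) \<and>
          (\<forall>k\<in>topos_groups.trivializing_maps T A B q.
             \<exists>!s\<in>topos_groups.trivializations T B (topos_groups.trivial_torsor T A B) \<E>.
               topos_groups.section_describes T B s k))"
proof -
  interpret topos_groups T A B by fact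
  show ?thesis
  proof (intro conjI ballI impI)
    show "\<exists>!q\<in>quadruples. describes E q" if "E \<in> alternating_structures trivial_torsor" for E
      by (rule ex_ex1I) (use ex_quadruple [OF that] quadruple_unique in blast)+
    show "\<exists>!E\<in>alternating_structures trivial_torsor. describes E q" if "q \<in> quadruples" for q
      by (rule ex_ex1I) (use ex_structure [OF that] structure_unique in blast)+
  qed (use trivializations_correspond in blast)+
qed

end
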